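(* Let $0<\mu<\beta<\infty$ and $\sigma>0$ with $\tau_2=\mu+\sigma^2/\mu<\beta$. The optimal robust price $p^*_{(\mu,\sigma,\beta)}=\arg\sup_{p>0}\inf_{\mathbb{P}\in\mathcal{P}(\mu,\sigma,\beta)}\mathrm{CR}(p,\mathbb{P})$ is $$p^*_{(\mu,\sigma,\beta)}=\begin{cases}p_l^*, & \sigma\le\sigma^*,\\ p_h^*=\max\{p_{h1}^*,p_{h2}^*\}, & \sigma\ge\sigma^*,\end{cases}$$ with $$p_l^*=\mu-\sigma\left(\left(\tfrac{\mu}{2\sigma}+\sqrt{\tfrac{8}{27}+\left(\tfrac{\mu}{2\sigma}\right)^2}\right)^{1/3}+\left(\tfrac{\mu}{2\sigma}-\sqrt{\tfrac{8}{27}+\left(\tfrac{\mu}{2\sigma}\right)^2}\right)^{1/3}\right),$$ $$p_{h1}^*=\tfrac12\left(\beta+\tau_2-\sqrt{(3\beta-\tau_2)^2-4\beta^2}\right),\qquad p_{h2}^*=\tfrac{\tau_2}{2}.$$ Furthermore, $\sigma^*$ is implicitly defined as the solution to $R(p_l^*,\sigma^* )=R(p_h^*,\sigma^* )$ (with $p_l^*$ and $p_h^*$, which depend on $\sigma$, evaluated at $\sigma=\sigma^*$).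
   Context: $\mathcal{P}(\mu,\sigma,\beta)$ is the set of all probability distributions $\mathbb{P}$ of a real random variable $X$ with $\mathbb{P}(X\in[0,\beta])=1$, $\mathbb{E}_{\mathbb{P}}(X)=\mu$ and variance $\sigma^2$, i.e. $\mathbb{E}_{\mathbb{P}}(X^2)=\mu^2+\sigma^2$. For $p>0$, $\mathrm{CR}(p,\mathbb{P})=\dfrac{p\,\mathbb{P}(X\ge p)}{\sup_{t>0}t\,\mathbb{P}(X\ge t)}$ is the competitive ratio, and $R(p,\sigma)=\inf_{\mathbb{P}\in\mathcal{P}(\mu,\sigma,\beta)}\mathrm{CR}(p,\mathbb{P})$. Cube roots are real cube roots.
   Formalization: The equation R(p_l*,σ)=R(p_h*,σ) can have a second, smaller solution where p_l*=p_h* (e.g. β=1, μ=0.3, σ≈0.146), so "the solution" σ* is taken as the largest one, all others being shown smaller with p_l*=p_h*; at σ=σ* the maximizers are exactly p_l* and p_h*. *)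

theory Defs
  imports "HOL-Probability.Probability"
begin

text \<open>
  A distribution of a real random variable \<open>X\<close> is a Borel probability measure on the reals,
  with \<open>X\<close> the identity.
\<close>

definition ambiguity_set :: "real \<Rightarrow> real \<Rightarrow> real \<Rightarrow> real measure set" where
  "ambiguity_set \<mu> \<sigma> \<beta> =
     {P. prob_space P \<and> sets P = sets borel \<and> measure P {0..\<beta>} = 1 \<and>
         prob_space.expectation P (\<lambda>x. x) = \<mu> \<and>
         prob_space.variance P (\<lambda>x. x) = \<sigma>\<^sup>2}"

text \<open>
  The supremum below is a genuine one on the ambiguity set: there
  \<open>t * measure P {t..}\<close> lies between 0 and \<open>\<beta>\<close> for all \<open>t > 0\<close>, and it is positive
  for some \<open>t\<close> because the mean is positive.
\<close>

definition CR :: "real \<Rightarrow> real measure \<Rightarrow> real" where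
  "CR p P = p * measure P {p..} / (SUP t\<in>{0<..}. t * measure P {t..})"

text \<open>
  The ambiguity set is nonempty when \<open>0 < \<mu>\<close>, \<open>0 < \<sigma>\<close> and \<open>\<tau>2 \<mu> \<sigma> < \<beta>\<close>
  (it contains a distribution on 0 and \<open>\<tau>2 \<mu> \<sigma>\<close>), and the ratios are nonnegative, so
  the real infimum is the intended one.
\<close>

definition robust_ratio :: "real \<Rightarrow> real \<Rightarrow> real \<Rightarrow> real \<Rightarrow> real" where
  "robust_ratio \<mu> \<beta> p \<sigma> = (INF P\<in>ambiguity_set \<mu> \<sigma> \<beta>. CR p P)"

definition optimal_prices :: "real \<Rightarrow> real \<Rightarrow> real \<Rightarrow> real set" where
  "optimal_prices \<mu> \<sigma> \<beta> = {p. is_arg_max (\<lambda>p. robust_ratio \<mu> \<beta> p \<sigma>) (\<lambda>p. 0 < p) p}"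

definition \<tau>2 :: "real \<Rightarrow> real \<Rightarrow> real" where
  "\<tau>2 \<mu> \<sigma> = \<mu> + \<sigma>\<^sup>2 / \<mu>"

text \<open>\<open>root 3\<close> is the real cube root, also for the negative second argument.\<close>

definition p_l :: "real \<Rightarrow> real \<Rightarrow> real" where
  "p_l \<mu> \<sigma> =
     \<mu> - \<sigma> * (root 3 (\<mu> / (2 * \<sigma>) + sqrt (8 / 27 + (\<mu> / (2 * \<sigma>))\<^sup>2)) +
              root 3 (\<mu> / (2 * \<sigma>) - sqrt (8 / 27 + (\<mu> / (2 * \<sigma>))\<^sup>2)))"

definition p_h1 :: "real \<Rightarrow> real \<Rightarrow> real \<Rightarrow> real" where
  "p_h1 \<mu> \<sigma> \<beta> = 1 / 2 * (\<beta> + \<tau>2 \<mu> \<sigma> - sqrt ((3 * \<beta> - \<tau>2 \<mu> \<sigma>)\<^sup>2 - 4 * \<beta>\<^sup>2))"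

definition p_h2 :: "real \<Rightarrow> real \<Rightarrow> real" where
  "p_h2 \<mu> \<sigma> = \<tau>2 \<mu> \<sigma> / 2"

definition p_h :: "real \<Rightarrow> real \<Rightarrow> real \<Rightarrow> real" where
  "p_h \<mu> \<sigma> \<beta> = max (p_h1 \<mu> \<sigma> \<beta>) (p_h2 \<mu> \<sigma>)"

text \<open>
  The equation that defines the threshold \<open>\<sigma>*\<close>, on the admissible range of \<open>\<sigma>\<close>. For some
  \<open>\<mu>\<close> and \<open>\<beta>\<close> it has, besides the threshold, a smaller solution at which the two candidate
  prices coincide, so that both sides are trivially equal.
\<close>

definition threshold_eq :: "real \<Rightarrow> real \<Rightarrow> real \<Rightarrow> bool" where
  "threshold_eq \<mu> \<beta> \<sigma> \<longleftrightarrow> 0 < \<sigma> \<and> \<tau>2 \<mu> \<sigma> < \<beta> \<and>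
     robust_ratio \<mu> \<beta> (p_l \<mu> \<sigma>) \<sigma> = robust_ratio \<mu> \<beta> (p_h \<mu> \<sigma> \<beta>) \<sigma>"

end

theory Submission
  imports Defs
begin

text \<open>
  Since the supremum in the denominator of the competitive ratio runs over all prices \<open>t\<close>, the
  adversary effectively chooses both a distribution and a price \<open>t\<close>, and minimises
  \<open>p * P(X \<ge> p) / (t * P(X \<ge> t))\<close>. Only two kinds of attack matter. Either the mass that lies
  above \<open>p\<close> sits at one far point \<open>z\<close>, so that the seller should have asked \<open>z\<close> and the ratio
  is \<open>p / z\<close>; or much mass sits just below \<open>p\<close>, so that a slightly smaller price would have sold
  with a far larger probability. Both attacks are carried out by distributions on \<open>0\<close>, a point
  \<open>x\<close> just below \<open>p\<close>, and \<open>z\<close>. If \<open>p \<le> \<mu> - \<sigma>\<^sup>2 / (\<beta> - \<mu>)\<close>, the distributions on \<open>x\<close> and its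
  partner \<open>\<mu> + \<sigma>\<^sup>2 / (\<mu> - x)\<close>, without mass at \<open>0\<close>, are the worst ones; for larger \<open>p\<close> the
  partner would exceed \<open>\<beta>\<close>, and \<open>z = \<beta>\<close> with a positive mass at \<open>0\<close> takes over. That nothing
  is worse than these distributions is linear programming duality: a quadratic polynomial below
  a combination of two tail indicators bounds the same combination of tail probabilities
  (\<open>quadratic_duality\<close>).

  The two regimes give two explicit lower bounds \<open>low_value\<close> and \<open>high_value\<close>. Each of them is a
  valid bound at every price, not only in its own regime, and so the robust ratio is their
  pointwise maximum (\<open>robust_ratio_eq\<close>). This removes the boundary between the regimes from
  the optimisation. Each bound is the minimum of the values of the two attacks, and has a unique
  maximiser: \<open>p_l\<close> for the low one, where the attack values \<open>p / partner\<close> and \<open>cantelli\<close> cross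
  (a cubic equation in \<open>\<mu> - p\<close>, solved by Cardano's formula); \<open>p_h\<close> for the high one, which is
  either the crossing point of \<open>p / \<beta>\<close> with \<open>drop_ratio\<close> or, if the crossing comes earlier, the
  point \<open>\<tau>2 / 2\<close> at which \<open>drop_ratio\<close> peaks. Hence the optimal prices are \<open>p_l\<close>, \<open>p_h\<close> or both,
  according to which of the two maximal values is larger.

  As \<open>\<sigma>\<close> grows, the maximal low value strictly decreases and the maximal high value does not
  decrease; the low one is larger near \<open>\<sigma> = 0\<close> and the high one near \<open>\<tau>2 = \<beta>\<close>. So they agree
  at exactly one \<open>\<sigma>\<close>, which is the threshold. The robust ratios of the two candidates can agree
  elsewhere only where the candidates coincide, and that cannot happen above the threshold
  (\<open>candidates_coincide\<close>).
\<close>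

section \<open>The values of the two attacks\<close>

text \<open>
  For \<open>x < \<mu>\<close>, the one point \<open>z\<close> for which a distribution on \<open>{x, z}\<close> has mean \<open>\<mu>\<close> and variance \<open>\<sigma>\<^sup>2\<close>.
\<close>
definition partner :: "real \<Rightarrow> real \<Rightarrow> real \<Rightarrow> real" where
  "partner \<mu> \<sigma> x = \<mu> + \<sigma>\<^sup>2 / (\<mu> - x)"

definition cantelli :: "real \<Rightarrow> real \<Rightarrow> real \<Rightarrow> real" where
  "cantelli \<mu> \<sigma> p = (\<mu> - p)\<^sup>2 / ((\<mu> - p)\<^sup>2 + \<sigma>\<^sup>2)"

text \<open>
  For a distribution on \<open>0\<close>, \<open>p\<close> and \<open>\<beta>\<close> whose mean is \<open>\<mu>\<close> and whose second moment is
  \<open>\<mu> * \<tau>\<close>, this is the share of the mass at \<open>\<beta>\<close> in the mass outside \<open>0\<close>: the factor by which the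
  probability of a sale drops when the price rises from \<open>p\<close> to just above it.
\<close>
definition drop_ratio :: "real \<Rightarrow> real \<Rightarrow> real \<Rightarrow> real" where
  "drop_ratio \<beta> \<tau> p = p * (\<tau> - p) / (p * (\<tau> - p) + \<beta> * (\<beta> - \<tau>))"

definition low_value :: "real \<Rightarrow> real \<Rightarrow> real \<Rightarrow> real" where
  "low_value \<mu> \<sigma> p =
     (if p < \<mu> then min (p / partner \<mu> \<sigma> p) (cantelli \<mu> \<sigma> p) else 0)"

definition high_value :: "real \<Rightarrow> real \<Rightarrow> real \<Rightarrow> real" where
  "high_value \<beta> \<tau> p = (if p < \<tau> then min (p / \<beta>) (drop_ratio \<beta> \<tau> p) else 0)"

section \<open>Moments, duality and competitive ratios\<close>

lemma
  assumes "P \<in> ambiguity_set \<mu> \<sigma> \<beta>"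
  shows ambiguity_set_prob_space: "prob_space P"
    and ambiguity_set_sets: "sets P = sets borel"
    and ambiguity_set_AE: "AE x in P. 0 \<le> x \<and> x \<le> \<beta>"
    and ambiguity_set_integrable: "integrable P (\<lambda>x. x)"
    and ambiguity_set_mean: "(\<integral>x. x \<partial>P) = \<mu>"
    and ambiguity_set_integrable_square: "integrable P (\<lambda>x. x\<^sup>2)"
    and ambiguity_set_second_moment: "(\<integral>x. x\<^sup>2 \<partial>P) = \<mu>\<^sup>2 + \<sigma>\<^sup>2"
proof -
  show ps: "prob_space P" and sets: "sets P = sets borel" and mean: "(\<integral>x. x \<partial>P) = \<mu>"
    using assms by (auto simp: ambiguity_set_def)
  interpret prob_space P by (rule ps)
  have [measurable_cong]: "sets P = sets borel" by (rule sets)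
  have "AE x in P. x \<in> {0..\<beta>}"
    using assms by (subst prob_eq_1[symmetric]) (auto simp: ambiguity_set_def sets)
  then show AE: "AE x in P. 0 \<le> x \<and> x \<le> \<beta>" by simp
  show int: "integrable P (\<lambda>x. x)"
  proof (rule integrable_const_bound[where B = \<beta>])
    show "AE x in P. norm x \<le> \<beta>" using AE by (rule eventually_mono) auto
  qed auto
  show int2: "integrable P (\<lambda>x. x\<^sup>2)"
  proof (rule integrable_const_bound[where B = "\<beta>\<^sup>2"])
    show "AE x in P. norm (x\<^sup>2) \<le> \<beta>\<^sup>2"
      using AE by (rule eventually_mono) (auto intro!: power_mono)
  qed auto
  have "variance (\<lambda>x. x) = \<sigma>\<^sup>2" using assms by (auto simp: ambiguity_set_def)
  then show "(\<integral>x. x\<^sup>2 \<partial>P) = \<mu>\<^sup>2 + \<sigma>\<^sup>2"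
    using variance_eq[OF int int2] mean by simp
qed

text \<open>
  Weak duality for the moment problem. The lower bounds on competitive ratios rest on this lemma:
  each of them uses a quadratic polynomial that meets the step function, possibly only as a
  one-sided limit, on the support of the worst distribution.
\<close>
lemma quadratic_duality:
  assumes P: "P \<in> ambiguity_set \<mu> \<sigma> \<beta>"
    and le: "\<And>x. 0 \<le> x \<Longrightarrow> x \<le> \<beta> \<Longrightarrow>
      a * x\<^sup>2 + b * x + c \<le> u * indicator {p..} x - v * indicator {t..} x"
  shows "a * (\<mu>\<^sup>2 + \<sigma>\<^sup>2) + b * \<mu> + c \<le> u * measure P {p..} - v * measure P {t..}"
proof -
  interpret prob_space P by (rule ambiguity_set_prob_space[OF P])
  note int = ambiguity_set_integrable[OF P] ambiguity_set_integrable_square[OF P]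
  have sets[measurable_cong]: "sets P = sets borel" by (rule ambiguity_set_sets[OF P])
  have ind: "integrable P (indicator {s..} :: real \<Rightarrow> real)" for s :: real
    by (rule integrable_real_indicator) (auto simp: sets emeasure_eq_measure)
  have meas: "(\<integral>x. indicator {s..} x \<partial>P) = measure P {s..}" for s :: real
    by (simp add: sets sets_eq_imp_space_eq)
  have "(\<integral>x. a * x\<^sup>2 + b * x + c \<partial>P)
      \<le> (\<integral>x. u * indicator {p..} x - v * indicator {t..} x \<partial>P)"
  proof (rule integral_mono_AE)
    show "AE x in P. a * x\<^sup>2 + b * x + c \<le> u * indicator {p..} x - v * indicator {t..} x"
      using ambiguity_set_AE[OF P] by (rule eventually_mono) (rule le, auto)
  qed (use int ind in auto)
  moreover have "(\<integral>x. a * x\<^sup>2 + b * x + c \<partial>P) = a * (\<mu>\<^sup>2 + \<sigma>\<^sup>2) + b * \<mu> + c"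
    using int by (simp add: ambiguity_set_mean[OF P] ambiguity_set_second_moment[OF P] prob_space)
  moreover have "(\<integral>x. u * indicator {p..} x - v * indicator {t..} x \<partial>P)
      = u * measure P {p..} - v * measure P {t..}"
    using ind by (simp add: meas)
  ultimately show ?thesis by simp
qed

lemma tail_beyond_support:
  assumes P: "P \<in> ambiguity_set \<mu> \<sigma> \<beta>" and "\<beta> < t"
  shows "measure P {t..} = 0"
proof -
  have "0 * (\<mu>\<^sup>2 + \<sigma>\<^sup>2) + 0 * \<mu> + 0 \<le> 0 * measure P {t..} - 1 * measure P {t..}"
    by (rule quadratic_duality[OF P]) (use \<open>\<beta> < t\<close> in auto)
  then show ?thesis using measure_nonneg[of P "{t..}"] by linarith
qed

lemma revenue_le:
  assumes P: "P \<in> ambiguity_set \<mu> \<sigma> \<beta>" and "0 < t"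
  shows "t * measure P {t..} \<le> \<beta>"
proof -
  interpret prob_space P by (rule ambiguity_set_prob_space[OF P])
  have \<beta>: "0 \<le> \<beta>"
  proof -
    have "AE x in P. 0 \<le> \<beta>"
      using ambiguity_set_AE[OF P] by (rule eventually_mono) auto
    then show ?thesis by simp
  qed
  show ?thesis
  proof (cases "t \<le> \<beta>")
    case True
    have "t * measure P {t..} \<le> t * 1"
      using \<open>0 < t\<close> by (intro mult_left_mono prob_le_1) auto
    then show ?thesis using True by simp
  next
    case False
    then show ?thesis using \<beta> tail_beyond_support[OF P] by simp
  qed
qed

lemma revenue_bdd_above:
  assumes "P \<in> ambiguity_set \<mu> \<sigma> \<beta>"
  shows "bdd_above ((\<lambda>t. t * measure P {t..}) ` {0<..})"
  using revenue_le[OF assms] by (intro bdd_aboveI2[where M = \<beta>]) auto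

lemma revenue_le_SUP:
  assumes "P \<in> ambiguity_set \<mu> \<sigma> \<beta>" and "0 < t"
  shows "t * measure P {t..} \<le> (SUP t\<in>{0<..}. t * measure P {t..})"
  by (rule cSUP_upper[OF _ revenue_bdd_above[OF assms(1)]]) (use assms(2) in auto)

text \<open>
  On \<open>[0, \<beta>]\<close> the affine function \<open>x - \<mu> / 2\<close> is at most \<open>\<beta>\<close> times the indicator of
  \<open>[\<mu> / 2, \<infinity>)\<close> and has the positive expectation \<open>\<mu> / 2\<close>, so the price \<open>\<mu> / 2\<close> earns something.
\<close>
lemma SUP_revenue_pos:
  assumes P: "P \<in> ambiguity_set \<mu> \<sigma> \<beta>" and "0 < \<mu>"
  shows "0 < (SUP t\<in>{0<..}. t * measure P {t..})"
proof -
  have "0 * (\<mu>\<^sup>2 + \<sigma>\<^sup>2) + 1 * \<mu> + (- (\<mu> / 2))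
      \<le> \<beta> * measure P {\<mu> / 2..} - 0 * measure P {\<mu> / 2..}"
    by (rule quadratic_duality[OF P]) (use \<open>0 < \<mu>\<close> in \<open>auto simp: indicator_def\<close>)
  then have "measure P {\<mu> / 2..} \<noteq> 0" using \<open>0 < \<mu>\<close> by auto
  then have "0 < \<mu> / 2 * measure P {\<mu> / 2..}"
    using \<open>0 < \<mu>\<close> by (simp add: measure_nonneg order_less_le)
  then show ?thesis using revenue_le_SUP[OF P, of "\<mu> / 2"] \<open>0 < \<mu>\<close> by simp
qed

lemma CR_nonneg:
  assumes "P \<in> ambiguity_set \<mu> \<sigma> \<beta>" "0 < \<mu>" "0 < p"
  shows "0 \<le> CR p P"
  using SUP_revenue_pos[OF assms(1,2)] assms(3) by (simp add: CR_def)

lemma CR_ge: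
  assumes P: "P \<in> ambiguity_set \<mu> \<sigma> \<beta>" and "0 < \<mu>" "0 \<le> r"
    and le: "\<And>t. 0 < t \<Longrightarrow> r * (t * measure P {t..}) \<le> p * measure P {p..}"
  shows "r \<le> CR p P"
proof (cases "r = 0")
  case True
  have "0 \<le> p * measure P {p..}" using le[of 1] True by simp
  then show ?thesis using SUP_revenue_pos[OF P \<open>0 < \<mu>\<close>] True by (simp add: CR_def)
next
  case False
  then have "0 < r" using \<open>0 \<le> r\<close> by simp
  have "(SUP t\<in>{0<..}. t * measure P {t..}) \<le> p * measure P {p..} / r"
    using \<open>0 < r\<close> le by (intro cSUP_least) (auto simp: field_simps)
  then show ?thesis using SUP_revenue_pos[OF P \<open>0 < \<mu>\<close>] \<open>0 < r\<close>
    by (simp add: CR_def field_simps)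
qed

lemma CR_le:
  assumes P: "P \<in> ambiguity_set \<mu> \<sigma> \<beta>" and "0 < p" "0 < t" "0 < measure P {t..}"
  shows "CR p P \<le> p * measure P {p..} / (t * measure P {t..})"
  unfolding CR_def
  using assms revenue_le_SUP[OF P \<open>0 < t\<close>] 
  by (intro divide_left_mono) (auto intro!: mult_pos_pos order.strict_trans2[OF _ revenue_le_SUP[OF P \<open>0 < t\<close>]])

section \<open>Three-point distributions\<close>

text \<open>
  The adversary's distributions. The three weights are the solution of the moment equations for
  the support \<open>{0, x, z}\<close>; the conditions \<open>x \<le> \<tau>2 \<le> z\<close> and \<open>(\<mu> - x) * (z - \<mu>) \<le> \<sigma>\<^sup>2\<close> say that
  the weights at \<open>z\<close>, \<open>x\<close> and \<open>0\<close> are nonnegative. Equality in one of them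
  yields a two-point distribution.
\<close>
lemma three_point_distribution:
  fixes x z :: real
  assumes "0 < \<mu>" "0 < x" "x < z" "z \<le> \<beta>" "x \<le> \<tau>2 \<mu> \<sigma>" "\<tau>2 \<mu> \<sigma> \<le> z"
    and w0: "(\<mu> - x) * (z - \<mu>) \<le> \<sigma>\<^sup>2"
  obtains P where "P \<in> ambiguity_set \<mu> \<sigma> \<beta>"
    and "\<And>t. 0 < t \<Longrightarrow> measure P {t..} =
      (if t \<le> x then \<mu> * (z - \<tau>2 \<mu> \<sigma>) / (x * (z - x)) else 0) +
      (if t \<le> z then \<mu> * (\<tau>2 \<mu> \<sigma> - x) / (z * (z - x)) else 0)"
proof -
  \<comment> \<open>The expectations of \<open>X * (z - X)\<close> and \<open>X * (X - x)\<close> isolate the masses at \<open>x\<close> and \<open>z\<close>.\<close>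
  define wx where "wx = \<mu> * (z - \<tau>2 \<mu> \<sigma>) / (x * (z - x))"
  define wz where "wz = \<mu> * (\<tau>2 \<mu> \<sigma> - x) / (z * (z - x))"
  have pos: "0 < x" "0 < z" "0 < z - x" using assms by auto
  have \<tau>: "\<mu> * \<tau>2 \<mu> \<sigma> = \<mu>\<^sup>2 + \<sigma>\<^sup>2"
    using assms by (simp add: \<tau>2_def power2_eq_square field_simps)
  have wx: "wx * (x * (z - x)) = \<mu> * z - (\<mu>\<^sup>2 + \<sigma>\<^sup>2)"
  proof -
    have "wx * (x * (z - x)) = \<mu> * (z - \<tau>2 \<mu> \<sigma>)" using pos by (simp add: wx_def)
    then show ?thesis using \<tau> by (simp only: right_diff_distrib)
  qed
  have wz: "wz * (z * (z - x)) = (\<mu>\<^sup>2 + \<sigma>\<^sup>2) - \<mu> * x"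
  proof -
    have "wz * (z * (z - x)) = \<mu> * (\<tau>2 \<mu> \<sigma> - x)" using pos by (simp add: wz_def)
    then show ?thesis using \<tau> by (simp only: right_diff_distrib)
  qed
  have m1: "x * wx + z * wz = \<mu>"
  proof -
    have "(x * wx + z * wz) * (z - x) = \<mu> * (z - x)" using wx wz by (simp add: algebra_simps)
    then show ?thesis using pos by simp
  qed
  have m2: "x\<^sup>2 * wx + z\<^sup>2 * wz = \<mu>\<^sup>2 + \<sigma>\<^sup>2"
  proof -
    have "(x\<^sup>2 * wx + z\<^sup>2 * wz) * (z - x) = x * (wx * (x * (z - x))) + z * (wz * (z * (z - x)))"
      by (simp add: algebra_simps power2_eq_square)
    also have "\<dots> = (\<mu>\<^sup>2 + \<sigma>\<^sup>2) * (z - x)" unfolding wx wz by (simp add: algebra_simps)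
    finally show ?thesis using pos by simp
  qed
  have nonneg: "0 \<le> wx" "0 \<le> wz" using assms by (auto simp: wx_def wz_def)
  have sum: "wx + wz \<le> 1"
  proof -
    \<comment> \<open>Both sides are the expectation of \<open>(X - x) * (X - z)\<close>.\<close>
    have "(1 - wx - wz) * (x * z) = \<sigma>\<^sup>2 - (\<mu> - x) * (z - \<mu>)"
    proof -
      have "(1 - wx - wz) * (x * z) = x * z - (x * wx) * z - (z * wz) * x"
        by (simp add: algebra_simps)
      also have "\<dots> = x * z - (x * wx + z * wz) * (x + z) + (x\<^sup>2 * wx + z\<^sup>2 * wz)"
        by (simp add: algebra_simps power2_eq_square)
      finally show ?thesis unfolding m1 m2 by (simp add: algebra_simps power2_eq_square)
    qed
    then have "0 \<le> (1 - wx - wz) * (x * z)" using w0 by simp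
    moreover have "0 < x * z" using pos by simp
    ultimately have "0 \<le> 1 - wx - wz" using mult_neg_pos[of "1 - wx - wz" "x * z"] by linarith
    then show ?thesis by simp
  qed
  define xs where "xs = [(0, 1 - wx - wz), (x, wx), (z, wz)]"
  have wf: "pmf_of_list_wf xs"
    using nonneg sum by (auto simp: pmf_of_list_wf_def xs_def)
  define Q where "Q = pmf_of_list xs"
  define P where "P = distr (measure_pmf Q) borel (\<lambda>x. x)"
  have setQ: "set_pmf Q \<subseteq> {0, x, z}"
    using set_pmf_of_list[OF wf] by (simp add: Q_def xs_def)
  have E: "(\<integral>y. f y \<partial>P) = f 0 * (1 - wx - wz) + f x * wx + f z * wz"
    if [measurable]: "f \<in> borel_measurable borel" for f :: "real \<Rightarrow> real"
  proof -
    have "(\<integral>y. f y \<partial>P) = (\<integral>y. f y \<partial>measure_pmf Q)"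
      unfolding P_def by (rule integral_distr) auto
    also have "\<dots> = (\<Sum>a\<in>{0, x, z}. f a * pmf Q a)"
      by (rule integral_measure_pmf_real) (use setQ in auto)
    also have "\<dots> = f 0 * (1 - wx - wz) + f x * wx + f z * wz"
      using pos unfolding Q_def pmf_pmf_of_list[OF wf] by (auto simp: xs_def)
    finally show ?thesis .
  qed
  have M: "measure P A = sum_list (map snd (filter (\<lambda>y. fst y \<in> A) xs))" if "A \<in> sets borel" for A
    unfolding P_def using that by (subst measure_distr) (auto simp: Q_def measure_pmf_of_list[OF wf])
  have ps: "prob_space P"
    unfolding P_def by (rule measure_pmf.prob_space_distr) simp
  interpret prob_space P by (rule ps)
  have "variance (\<lambda>y. y) = \<sigma>\<^sup>2"
  proof -
    have "variance (\<lambda>y. y) = (\<mu>)\<^sup>2 * (1 - wx - wz) + (x - \<mu>)\<^sup>2 * wx + (z - \<mu>)\<^sup>2 * wz"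
      using m1 by (simp add: E mult.commute)
    also have "\<dots> = (x\<^sup>2 * wx + z\<^sup>2 * wz) - 2 * \<mu> * (x * wx + z * wz) + \<mu>\<^sup>2"
      by (simp add: algebra_simps power2_eq_square)
    finally show ?thesis unfolding m1 m2 by (simp add: power2_eq_square)
  qed
  moreover have mean: "expectation (\<lambda>y. y) = \<mu>" using m1 by (simp add: E mult.commute)
  moreover have sets: "sets P = sets borel" by (simp add: P_def)
  moreover have "measure P {0..\<beta>} = 1"
    using pos assms by (subst M) (auto simp: xs_def)
  ultimately have "P \<in> ambiguity_set \<mu> \<sigma> \<beta>"
    using ps mean sets unfolding ambiguity_set_def by blast
  moreover have "measure P {t..} = (if t \<le> x then wx else 0) + (if t \<le> z then wz else 0)"
    if "0 < t" for t
    using that pos by (subst M) (auto simp: xs_def)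
  ultimately show thesis using that unfolding wx_def wz_def by blast
qed

section \<open>Bounds on tail probabilities\<close>

lemma partner_gt_mean:
  assumes "0 < \<sigma>" "x < \<mu>"
  shows "\<mu> < partner \<mu> \<sigma> x"
  using assms by (simp add: partner_def)

lemma partner_mult:
  assumes "x < \<mu>"
  shows "(\<mu> - x) * (partner \<mu> \<sigma> x - \<mu>) = \<sigma>\<^sup>2"
  using assms by (simp add: partner_def)

lemma mean_less_\<tau>2:
  assumes "0 < \<mu>" "0 < \<sigma>"
  shows "\<mu> < \<tau>2 \<mu> \<sigma>"
  using assms by (simp add: \<tau>2_def)

lemma mean_times_\<tau>2:
  assumes "0 < \<mu>"
  shows "\<mu> * \<tau>2 \<mu> \<sigma> = \<mu>\<^sup>2 + \<sigma>\<^sup>2"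
  using assms by (simp add: \<tau>2_def power2_eq_square field_simps)

lemma cantelli_eq:
  assumes "0 < \<sigma>" "p < \<mu>"
  shows "cantelli \<mu> \<sigma> p = (\<mu> - p) / (partner \<mu> \<sigma> p - p)"
proof -
  define y where "y = \<mu> - p"
  have y: "0 < y" using assms by (simp add: y_def)
  have k: "partner \<mu> \<sigma> p - p = (y\<^sup>2 + \<sigma>\<^sup>2) / y"
    using y by (simp add: partner_def y_def[symmetric] add_divide_distrib power2_eq_square)
  show ?thesis
    unfolding k cantelli_def y_def[symmetric] using y by (simp add: power2_eq_square)
qed

text \<open>
  The parabola \<open>1 - ((x - m) / (m - p))\<^sup>2\<close>, where \<open>m\<close> is the partner of \<open>p\<close>, vanishes at \<open>p\<close>
  and peaks at \<open>m\<close> with value \<open>1\<close>, so it lies below the indicator of \<open>[p, \<infinity>)\<close> and touches it at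
  \<open>m\<close> and, from the left, at \<open>p\<close>: the points between which the worst distribution splits its mass.
\<close>
lemma cantelli_inequality:
  assumes P: "P \<in> ambiguity_set \<mu> \<sigma> \<beta>" and \<sigma>: "0 < \<sigma>" and p: "p < \<mu>"
  shows "cantelli \<mu> \<sigma> p \<le> measure P {p..}"
proof -
  define m where "m = partner \<mu> \<sigma> p"
  have k: "0 < m - p" using partner_gt_mean[OF \<sigma> p] p by (simp add: m_def)
  have s: "\<sigma>\<^sup>2 = (\<mu> - p) * (m - \<mu>)" using partner_mult[OF p] by (simp add: m_def)
  have q: "- 1 / (m - p)\<^sup>2 * X + 2 * m / (m - p)\<^sup>2 * x + (1 - m\<^sup>2 / (m - p)\<^sup>2)
      = 1 - (X - 2 * m * x + m\<^sup>2) / (m - p)\<^sup>2" for x X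
    by (simp add: diff_divide_distrib add_divide_distrib)
  have sq: "x\<^sup>2 - 2 * m * x + m\<^sup>2 = (x - m)\<^sup>2" for x
    by (simp add: power2_eq_square algebra_simps)
  have "- 1 / (m - p)\<^sup>2 * (\<mu>\<^sup>2 + \<sigma>\<^sup>2) + 2 * m / (m - p)\<^sup>2 * \<mu> + (1 - m\<^sup>2 / (m - p)\<^sup>2)
      \<le> 1 * measure P {p..} - 0 * measure P {p..}"
  proof (rule quadratic_duality[OF P])
    fix x :: real
    have "1 \<le> (x - m)\<^sup>2 / (m - p)\<^sup>2" if "x < p"
    proof -
      have "(m - p)\<^sup>2 \<le> (m - x)\<^sup>2" using that k by (intro power_mono) auto
      then show ?thesis using k by (simp add: power2_commute[of x m])
    qed
    then show "- 1 / (m - p)\<^sup>2 * x\<^sup>2 + 2 * m / (m - p)\<^sup>2 * x + (1 - m\<^sup>2 / (m - p)\<^sup>2)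
        \<le> 1 * indicator {p..} x - 0 * indicator {p..} x"
      unfolding q sq by (auto simp: indicator_def)
  qed
  moreover have "1 - (\<mu>\<^sup>2 + \<sigma>\<^sup>2 - 2 * m * \<mu> + m\<^sup>2) / (m - p)\<^sup>2 = (\<mu> - p) / (m - p)"
  proof -
    have "\<mu>\<^sup>2 + \<sigma>\<^sup>2 - 2 * m * \<mu> + m\<^sup>2 = (m - \<mu>) * (m - p)"
      unfolding s by (simp add: power2_eq_square algebra_simps)
    then have "1 - (\<mu>\<^sup>2 + \<sigma>\<^sup>2 - 2 * m * \<mu> + m\<^sup>2) / (m - p)\<^sup>2 = 1 - (m - \<mu>) / (m - p)"
      using k by (simp add: power2_eq_square)
    also have "\<dots> = (\<mu> - p) / (m - p)" using k by (simp add: field_simps)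
    finally show ?thesis .
  qed
  ultimately have "(\<mu> - p) / (m - p) \<le> measure P {p..}" unfolding q by simp
  then show ?thesis by (simp add: cantelli_eq[OF \<sigma> p] m_def)
qed

text \<open>
  No distribution without mass between \<open>p\<close> and \<open>t\<close> exists once \<open>t\<close> exceeds the partner of \<open>p\<close>, so
  moving the far mass further out forces mass into \<open>[p, t)\<close>. The dual certificate is the parabola
  with zeros at \<open>p\<close> and at its partner \<open>m\<close>, scaled to have maximum \<open>1\<close> at the midpoint \<open>c\<close>. Its
  expectation is \<open>0\<close>, and it is at most \<open>1 - t / m\<close> from \<open>t\<close> on.
\<close>
lemma tail_beyond_partner:
  assumes P: "P \<in> ambiguity_set \<mu> \<sigma> \<beta>" and \<sigma>: "0 < \<sigma>" and p: "0 < p" "p < \<mu>"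
    and t: "partner \<mu> \<sigma> p \<le> t"
  shows "t / partner \<mu> \<sigma> p * measure P {t..} \<le> measure P {p..}"
proof -
  define m where "m = partner \<mu> \<sigma> p"
  define c h where "c = (m + p) / 2" and "h = (m - p) / 2"
  have mp: "\<mu> < m" using partner_gt_mean[OF \<sigma> p(2)] by (simp add: m_def)
  have h: "0 < h" using mp p by (simp add: h_def)
  have c: "0 < c" "m = c + h" "p = c - h" using mp p by (auto simp: c_def h_def field_simps)
  have s: "\<sigma>\<^sup>2 = (\<mu> - p) * (m - \<mu>)" using partner_mult[OF p(2)] by (simp add: m_def)
  have q: "- 1 / h\<^sup>2 * X + 2 * c / h\<^sup>2 * x + (1 - c\<^sup>2 / h\<^sup>2) = 1 - (X - 2 * c * x + c\<^sup>2) / h\<^sup>2" for x X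
    by (simp add: diff_divide_distrib add_divide_distrib)
  have sq: "x\<^sup>2 - 2 * c * x + c\<^sup>2 = (x - c)\<^sup>2" for x
    by (simp add: power2_eq_square algebra_simps)
  have "- 1 / h\<^sup>2 * (\<mu>\<^sup>2 + \<sigma>\<^sup>2) + 2 * c / h\<^sup>2 * \<mu> + (1 - c\<^sup>2 / h\<^sup>2)
      \<le> 1 * measure P {p..} - t / m * measure P {t..}"
  proof (rule quadratic_duality[OF P])
    fix x :: real
    have below: "1 \<le> (x - c)\<^sup>2 / h\<^sup>2" if "x < p"
    proof -
      have "h\<^sup>2 \<le> (c - x)\<^sup>2" using that h c by (intro power_mono) auto
      then show ?thesis using h by (simp add: power2_commute[of x c])
    qed
    have above: "t / m \<le> (x - c)\<^sup>2 / h\<^sup>2" if "t \<le> x"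
    proof -
      have m: "0 < m" "m \<le> t" using t p mp by (auto simp: m_def)
      have "1 \<le> (t - c) / h" using m c h by (simp add: field_simps)
      have "t * h \<le> (t - c) * m"
      proof -
        have "(t - c) * m - t * h = c * (t - m)" unfolding c(2) by (simp add: algebra_simps)
        moreover have "0 \<le> c * (t - m)" using c m by simp
        ultimately show ?thesis by linarith
      qed
      then have "t / m \<le> (t - c) / h" using m h by (simp add: field_simps)
      also have "\<dots> \<le> ((t - c) / h)\<^sup>2" using \<open>1 \<le> (t - c) / h\<close> by (rule self_le_power) simp
      also have "\<dots> \<le> ((x - c) / h)\<^sup>2"
        using that h \<open>1 \<le> (t - c) / h\<close> by (intro power_mono divide_right_mono) auto
      finally show ?thesis by (simp add: power_divide)
    qed
    have "p < t" using t mp p by (simp add: m_def)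
    then show "- 1 / h\<^sup>2 * x\<^sup>2 + 2 * c / h\<^sup>2 * x + (1 - c\<^sup>2 / h\<^sup>2)
        \<le> 1 * indicator {p..} x - t / m * indicator {t..} x"
      unfolding q sq using below above by (auto simp: indicator_def)
  qed
  moreover have "\<mu>\<^sup>2 + \<sigma>\<^sup>2 - 2 * c * \<mu> + c\<^sup>2 = h\<^sup>2"
    unfolding s c(2,3) by (simp add: power2_eq_square algebra_simps)
  ultimately show ?thesis unfolding q using h by (simp add: m_def)
qed

text \<open>
  The certificate is \<open>a * x * (x - \<tau>2)\<close>, whose expectation is \<open>0\<close> because the second moment is
  \<open>\<mu> * \<tau>2\<close>. It vanishes at \<open>0\<close>, and the scale \<open>a\<close> is chosen such that it equals \<open>1 - l\<close> at \<open>\<beta>\<close>. For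
  \<open>t = p\<close> its value at \<open>p\<close> is \<open>- l\<close>, which is what the step function takes on \<open>[t, p)\<close>: in the limit
  \<open>t \<rightarrow> p\<close> the two touch at all three points of the worst distribution. The weight \<open>l\<close> is
  proportional to \<open>t\<close>, and this leaves slack for smaller \<open>t\<close>.
\<close>
lemma drop_ratio_tail:
  assumes P: "P \<in> ambiguity_set \<mu> \<sigma> \<beta>" and \<mu>: "0 < \<mu>" and \<tau>: "\<tau>2 \<mu> \<sigma> < \<beta>"
    and t: "0 < t" "t \<le> p" and p: "p < \<tau>2 \<mu> \<sigma>"
  shows "drop_ratio \<beta> (\<tau>2 \<mu> \<sigma>) p * (t * measure P {t..}) \<le> p * measure P {p..}"
proof -
  define T where "T = \<tau>2 \<mu> \<sigma>"
  define D where "D = T - p"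
  define C where "C = \<beta> * (\<beta> - T)"
  define N where "N = p * D + C"
  define a where "a = ((p - t) * D + C) / (C * N)"
  define l where "l = t * D / N"
  have D: "0 < D" using p by (simp add: D_def T_def)
  have \<beta>: "0 < \<beta>" using t p \<tau> by linarith
  have C: "0 < C" using \<tau> \<beta> by (simp add: C_def T_def)
  have N: "0 < N" using D C t by (simp add: N_def add_pos_pos)
  have CN: "0 < C * N" using C N by simp
  have a: "0 \<le> a" using D C N t by (simp add: a_def)
  have aC: "a * C = 1 - l"
    using C N by (simp add: a_def l_def) (simp add: N_def field_simps)
  have "a * (\<mu>\<^sup>2 + \<sigma>\<^sup>2) + (- a * T) * \<mu> + 0 \<le> 1 * measure P {p..} - l * measure P {t..}"
  proof (rule quadratic_duality[OF P])
    fix x :: real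
    assume x: "0 \<le> x" "x \<le> \<beta>"
    have eq: "a * x\<^sup>2 + (- a * T) * x + 0 = - (a * (x * (T - x)))"
      by (simp add: power2_eq_square algebra_simps)
    have 1: "0 \<le> a * (x * (T - x))" if "x < t"
      using a x that t p by (simp add: T_def)
    have 2: "l \<le> a * (x * (T - x))" if "t \<le> x" "x < p"
    proof -
      have "t * D \<le> x * (T - x)" using that t D by (intro mult_mono) (auto simp: D_def)
      moreover have "C \<le> (p - t) * D + C" using t D by simp
      ultimately have "C * (t * D) \<le> ((p - t) * D + C) * (x * (T - x))"
        using t D C by (metis add_nonneg_pos diff_ge_0_iff_ge less_imp_le mult_mono mult_nonneg_nonneg)
      then have "C * (t * D) / (C * N) \<le> ((p - t) * D + C) * (x * (T - x)) / (C * N)"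
        using CN by (intro divide_right_mono) auto
      then show ?thesis using C by (simp add: a_def l_def)
    qed
    have 3: "- (a * (x * (T - x))) \<le> 1 - l" if "p \<le> x"
    proof -
      have "x * (x - T) \<le> C"
      proof (cases "x \<le> T")
        case True
        then have "x * (x - T) \<le> 0" using x by (simp add: mult_nonneg_nonpos)
        then show ?thesis using C by simp
      next
        case False
        then show ?thesis unfolding C_def using x \<beta> by (intro mult_mono) auto
      qed
      then have "a * (x * (x - T)) \<le> a * C" using a by (rule mult_left_mono)
      then show ?thesis unfolding aC by (simp add: algebra_simps)
    qed
    show "a * x\<^sup>2 + (- a * T) * x + 0 \<le> 1 * indicator {p..} x - l * indicator {t..} x"
      unfolding eq using 1 2 3 t by (cases "x < t"; cases "x < p") (auto simp: indicator_def)
  qed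
  moreover have "a * (\<mu>\<^sup>2 + \<sigma>\<^sup>2) + (- a * T) * \<mu> + 0 = 0"
    using mean_times_\<tau>2[OF \<mu>, of \<sigma>] by (simp add: T_def mult.commute)
  ultimately have "l * measure P {t..} \<le> measure P {p..}" by linarith
  then have "p * (l * measure P {t..}) \<le> p * measure P {p..}"
    using t by (intro mult_left_mono) auto
  moreover have "drop_ratio \<beta> T p * (t * measure P {t..}) = p * (l * measure P {t..})"
    by (simp add: drop_ratio_def l_def N_def D_def C_def)
  ultimately show ?thesis unfolding T_def by linarith
qed

lemma low_value_nonneg:
  assumes "0 < \<mu>" "0 < \<sigma>" "0 < p"
  shows "0 \<le> low_value \<mu> \<sigma> p"
proof (cases "p < \<mu>")
  case True
  then have "0 \<le> partner \<mu> \<sigma> p" using partner_gt_mean[OF assms(2) True] assms(1) by simp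
  then show ?thesis using assms by (simp add: low_value_def cantelli_def)
qed (simp add: low_value_def)

lemma high_value_nonneg:
  assumes "0 < p" "T < \<beta>"
  shows "0 \<le> high_value \<beta> T p"
  using assms by (simp add: high_value_def drop_ratio_def)

text \<open>
  If \<open>z\<close> is the partner of \<open>x\<close>, the distribution on \<open>0\<close>, \<open>x\<close> and \<open>z\<close> puts no mass at \<open>0\<close>, so the
  share of \<open>z\<close> in the remaining mass is its whole probability, which attains Cantelli's bound.
\<close>
lemma drop_ratio_partner:
  assumes \<mu>: "0 < \<mu>" and \<sigma>: "0 < \<sigma>" and x: "0 < x" "x < \<mu>"
  shows "drop_ratio (partner \<mu> \<sigma> x) (\<tau>2 \<mu> \<sigma>) x = cantelli \<mu> \<sigma> x"
proof -
  define z where "z = partner \<mu> \<sigma> x"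
  define y where "y = \<mu> - x"
  have y: "0 < y" using x by (simp add: y_def)
  have z: "0 < z" using partner_gt_mean[OF \<sigma> x(2)] \<mu> by (simp add: z_def)
  have yz: "y * z = y * \<mu> + \<sigma>\<^sup>2"
    using partner_mult[OF x(2), of \<sigma>] by (simp add: y_def z_def algebra_simps)
  have 1: "\<mu> * (\<tau>2 \<mu> \<sigma> - x) = y * z"
    using mean_times_\<tau>2[OF \<mu>, of \<sigma>] unfolding yz by (simp add: y_def power2_eq_square algebra_simps)
  have 2: "y * (\<mu> * (z - \<tau>2 \<mu> \<sigma>)) = \<sigma>\<^sup>2 * x"
  proof -
    have "y * (\<mu> * (z - \<tau>2 \<mu> \<sigma>)) = \<mu> * (y * z) - y * (\<mu> * \<tau>2 \<mu> \<sigma>)" by (simp add: algebra_simps)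
    also have "\<dots> = \<sigma>\<^sup>2 * x" unfolding yz mean_times_\<tau>2[OF \<mu>]
      by (simp add: y_def power2_eq_square algebra_simps)
    finally show ?thesis .
  qed
  have "drop_ratio z (\<tau>2 \<mu> \<sigma>) x = (\<mu> * y * (x * (\<tau>2 \<mu> \<sigma> - x))) /
      (\<mu> * y * (x * (\<tau>2 \<mu> \<sigma> - x) + z * (z - \<tau>2 \<mu> \<sigma>)))"
    unfolding drop_ratio_def using \<mu> y by (subst mult_divide_mult_cancel_left) auto
  also have "\<mu> * y * (x * (\<tau>2 \<mu> \<sigma> - x)) = (x * z) * y\<^sup>2"
    using 1 by (simp add: power2_eq_square mult_ac)
  also have "\<mu> * y * (x * (\<tau>2 \<mu> \<sigma> - x) + z * (z - \<tau>2 \<mu> \<sigma>)) = (x * z) * (y\<^sup>2 + \<sigma>\<^sup>2)"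
  proof -
    have "\<mu> * y * (x * (\<tau>2 \<mu> \<sigma> - x) + z * (z - \<tau>2 \<mu> \<sigma>)) =
      x * y * (\<mu> * (\<tau>2 \<mu> \<sigma> - x)) + z * (y * (\<mu> * (z - \<tau>2 \<mu> \<sigma>)))" by (simp add: algebra_simps)
    also have "\<dots> = (x * z) * (y\<^sup>2 + \<sigma>\<^sup>2)"
      unfolding 1 2 by (simp add: algebra_simps power2_eq_square)
    finally show ?thesis .
  qed
  also have "(x * z) * y\<^sup>2 / ((x * z) * (y\<^sup>2 + \<sigma>\<^sup>2)) = cantelli \<mu> \<sigma> x"
    using x z by (simp add: cantelli_def y_def)
  finally show ?thesis by (simp add: z_def)
qed

section \<open>The robust ratio in closed form\<close>

context
  fixes \<mu> \<sigma> \<beta> :: real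
  assumes \<mu>: "0 < \<mu>" and \<sigma>: "0 < \<sigma>" and \<tau>: "\<tau>2 \<mu> \<sigma> < \<beta>"
begin

lemma low_value_le_CR:
  assumes P: "P \<in> ambiguity_set \<mu> \<sigma> \<beta>" and p: "0 < p"
  shows "low_value \<mu> \<sigma> p \<le> CR p P"
proof (cases "p < \<mu>")
  case False
  then show ?thesis using CR_nonneg[OF P \<mu> p] by (simp add: low_value_def)
next
  case p\<mu>: True
  interpret prob_space P by (rule ambiguity_set_prob_space[OF P])
  have sets: "sets P = sets borel" by (rule ambiguity_set_sets[OF P])
  define r where "r = low_value \<mu> \<sigma> p"
  define m where "m = partner \<mu> \<sigma> p"
  have r: "0 \<le> r" "r \<le> p / m" "r \<le> cantelli \<mu> \<sigma> p"
    using low_value_nonneg[OF \<mu> \<sigma> p] p\<mu> by (auto simp: r_def m_def low_value_def)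
  have m: "0 < m" using partner_gt_mean[OF \<sigma> p\<mu>] \<mu> by (simp add: m_def)
  have "r \<le> CR p P"
  proof (rule CR_ge[OF P \<mu> r(1)])
    fix t :: real assume t: "0 < t"
    consider "t \<le> p" | "p < t" "t \<le> m" | "m < t" by linarith
    then show "r * (t * measure P {t..}) \<le> p * measure P {p..}"
    proof cases
      case 1
      have "r * (t * measure P {t..}) \<le> measure P {p..} * (p * 1)"
        using r cantelli_inequality[OF P \<sigma> p\<mu>] t 1 by (intro mult_mono prob_le_1) auto
      then show ?thesis by (simp add: mult.commute)
    next
      case 2
      have "r * (t * measure P {t..}) \<le> p / m * (m * measure P {p..})"
        using r 2 t m p
        by (intro mult_mono finite_measure_mono) (auto simp: sets)
      then show ?thesis using m by simp
    next
      case 3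
      have "r * (t * measure P {t..}) \<le> p / m * (t * measure P {t..})"
        using r t by (intro mult_right_mono) auto
      also have "\<dots> = p * (t / m * measure P {t..})" by simp
      also have "\<dots> \<le> p * measure P {p..}"
        using tail_beyond_partner[OF P \<sigma> p p\<mu>, of t] 3 p
        by (intro mult_left_mono) (auto simp: m_def)
      finally show ?thesis .
    qed
  qed
  then show ?thesis by (simp add: r_def)
qed

lemma high_value_le_CR:
  assumes P: "P \<in> ambiguity_set \<mu> \<sigma> \<beta>" and p: "0 < p"
  shows "high_value \<beta> (\<tau>2 \<mu> \<sigma>) p \<le> CR p P"
proof (cases "p < \<tau>2 \<mu> \<sigma>")
  case False
  then show ?thesis using CR_nonneg[OF P \<mu> p] by (simp add: high_value_def)
next
  case p\<tau>: True
  interpret prob_space P by (rule ambiguity_set_prob_space[OF P])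
  have sets: "sets P = sets borel" by (rule ambiguity_set_sets[OF P])
  define r where "r = high_value \<beta> (\<tau>2 \<mu> \<sigma>) p"
  have r: "0 \<le> r" "r \<le> p / \<beta>" "r \<le> drop_ratio \<beta> (\<tau>2 \<mu> \<sigma>) p"
    using high_value_nonneg[OF p \<tau>] p\<tau> by (auto simp: r_def high_value_def)
  have \<beta>: "0 < \<beta>" using p p\<tau> \<tau> by linarith
  have "r \<le> CR p P"
  proof (rule CR_ge[OF P \<mu> r(1)])
    fix t :: real assume t: "0 < t"
    consider "t \<le> p" | "p < t" "t \<le> \<beta>" | "\<beta> < t" by linarith
    then show "r * (t * measure P {t..}) \<le> p * measure P {p..}"
    proof cases
      case 1
      have "r * (t * measure P {t..}) \<le> drop_ratio \<beta> (\<tau>2 \<mu> \<sigma>) p * (t * measure P {t..})"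
        using r t by (intro mult_right_mono) auto
      also have "\<dots> \<le> p * measure P {p..}" by (rule drop_ratio_tail[OF P \<mu> \<tau> t 1 p\<tau>])
      finally show ?thesis .
    next
      case 2
      have "r * (t * measure P {t..}) \<le> p / \<beta> * (\<beta> * measure P {p..})"
        using r 2 t \<beta> p by (intro mult_mono finite_measure_mono) (auto simp: sets)
      then show ?thesis using \<beta> by simp
    next
      case 3
      then show ?thesis using p tail_beyond_support[OF P] by simp
    qed
  qed
  then show ?thesis by (simp add: r_def)
qed

lemma robust_ratio_le_CR:
  assumes "P \<in> ambiguity_set \<mu> \<sigma> \<beta>" "0 < p"
  shows "robust_ratio \<mu> \<beta> p \<sigma> \<le> CR p P"
  unfolding robust_ratio_def
  by (rule cINF_lower[OF _ assms(1)]) (use CR_nonneg \<mu> assms(2) in \<open>auto intro!: bdd_belowI2\<close>)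

text \<open>
  With \<open>x\<close> below the price and \<open>z\<close> at or above it, the two bounds come from comparing the
  price with the benchmark prices \<open>z\<close> and \<open>x\<close>.
\<close>
lemma robust_ratio_le_three_point:
  assumes "0 < x" "x < p" "p \<le> z" "z \<le> \<beta>" "x < \<tau>2 \<mu> \<sigma>" "\<tau>2 \<mu> \<sigma> \<le> z"
    and "(\<mu> - x) * (z - \<mu>) \<le> \<sigma>\<^sup>2"
  shows "robust_ratio \<mu> \<beta> p \<sigma> \<le> p / z"
    and "robust_ratio \<mu> \<beta> p \<sigma> \<le> p / x * drop_ratio z (\<tau>2 \<mu> \<sigma>) x"
proof -
  define T where "T = \<tau>2 \<mu> \<sigma>"
  define wx where "wx = \<mu> * (z - T) / (x * (z - x))"
  define wz where "wz = \<mu> * (T - x) / (z * (z - x))"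
  have "x < z" "x \<le> \<tau>2 \<mu> \<sigma>" using assms by auto
  obtain P where P: "P \<in> ambiguity_set \<mu> \<sigma> \<beta>"
    and F: "\<And>t. 0 < t \<Longrightarrow> measure P {t..} = (if t \<le> x then wx else 0) + (if t \<le> z then wz else 0)"
    using three_point_distribution[OF \<mu> assms(1) \<open>x < z\<close> assms(4) \<open>x \<le> \<tau>2 \<mu> \<sigma>\<close> assms(6,7)]
    unfolding wx_def wz_def T_def by blast
  have p: "0 < p" using assms by simp
  have wz: "0 < wz" using assms \<mu> by (simp add: wz_def T_def)
  have wx: "0 \<le> wx" using assms \<mu> by (simp add: wx_def T_def)
  have Fp: "measure P {p..} = wz" and Fz: "measure P {z..} = wz" and Fx: "measure P {x..} = wx + wz"
    using assms by (auto simp: F)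
  have "robust_ratio \<mu> \<beta> p \<sigma> \<le> p * measure P {p..} / (z * measure P {z..})"
    using robust_ratio_le_CR[OF P p] CR_le[OF P p, of z] assms wz Fz by simp
  then show "robust_ratio \<mu> \<beta> p \<sigma> \<le> p / z" unfolding Fp Fz using wz by simp
  have "robust_ratio \<mu> \<beta> p \<sigma> \<le> p * measure P {p..} / (x * measure P {x..})"
    using robust_ratio_le_CR[OF P p] CR_le[OF P p, of x] assms wz wx Fx by simp
  also have "\<dots> = p / x * (wz / (wx + wz))" unfolding Fp Fx by simp
  also have "wz / (wx + wz) = drop_ratio z T x"
  proof -
    have "wz = \<mu> / (x * z * (z - x)) * (x * (T - x))"
      using assms by (simp add: wz_def)
    moreover have "wx = \<mu> / (x * z * (z - x)) * (z * (z - T))"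
      using assms by (simp add: wx_def)
    ultimately have "wz / (wx + wz) = (\<mu> / (x * z * (z - x)) * (x * (T - x))) /
        (\<mu> / (x * z * (z - x)) * (x * (T - x) + z * (z - T)))"
      by (simp only: distrib_left add.commute)
    also have "\<dots> = drop_ratio z T x"
      unfolding drop_ratio_def using assms \<mu> by (subst mult_divide_mult_cancel_left) auto
    finally show ?thesis .
  qed
  finally show "robust_ratio \<mu> \<beta> p \<sigma> \<le> p / x * drop_ratio z (\<tau>2 \<mu> \<sigma>) x" by (simp add: T_def)
qed

text \<open>
  Mass placed exactly at \<open>p\<close> would still buy, so the adversary's point \<open>x\<close> has to tend to \<open>p\<close>
  from below.
\<close>
lemma robust_ratio_le_of_left_limit:
  fixes f :: "real \<Rightarrow> real"
  assumes "\<And>x. a < x \<Longrightarrow> x < p \<Longrightarrow> robust_ratio \<mu> \<beta> p \<sigma> \<le> f x" "a < p" "(f \<longlongrightarrow> l) (at_left p)"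
  shows "robust_ratio \<mu> \<beta> p \<sigma> \<le> l"
proof (rule tendsto_lowerbound[OF assms(3)])
  show "\<forall>\<^sub>F x in at_left p. robust_ratio \<mu> \<beta> p \<sigma> \<le> f x"
    unfolding eventually_at_left_field using assms(1,2) by blast
qed simp

lemma robust_ratio_le_high:
  assumes p: "0 < p" "p \<le> \<tau>2 \<mu> \<sigma>" and ups: "(\<mu> - p) * (\<beta> - \<mu>) < \<sigma>\<^sup>2"
  shows "robust_ratio \<mu> \<beta> p \<sigma> \<le> p / \<beta>"
    and "robust_ratio \<mu> \<beta> p \<sigma> \<le> drop_ratio \<beta> (\<tau>2 \<mu> \<sigma>) p"
proof -
  have d: "0 < \<beta> - \<mu>" using mean_less_\<tau>2[OF \<mu> \<sigma>] \<tau> by simp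
  \<comment> \<open>To the right of \<open>a\<close> the mass at \<open>0\<close> is nonnegative when \<open>z = \<beta>\<close>.\<close>
  define a where "a = max 0 (\<mu> - \<sigma>\<^sup>2 / (\<beta> - \<mu>))"
  have a: "a < p" using ups p d by (auto simp: a_def field_simps)
  have w0: "(\<mu> - x) * (\<beta> - \<mu>) \<le> \<sigma>\<^sup>2" and x0: "0 < x" if "a < x" for x
    using that d by (auto simp: a_def field_simps)
  have "p \<le> \<beta>" using p \<tau> by simp
  note bound = robust_ratio_le_three_point[OF x0 _ \<open>p \<le> \<beta>\<close> order.refl _ less_imp_le[OF \<tau>] w0]
  obtain x where "a < x" "x < p" using dense[OF a] by auto
  then show "robust_ratio \<mu> \<beta> p \<sigma> \<le> p / \<beta>" using bound(1)[of x] p by simp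
  have pos: "0 < p * (\<tau>2 \<mu> \<sigma> - p) + \<beta> * (\<beta> - \<tau>2 \<mu> \<sigma>)"
    using p \<tau> by (intro add_nonneg_pos) auto
  have "((\<lambda>x. p / x * drop_ratio \<beta> (\<tau>2 \<mu> \<sigma>) x) \<longlongrightarrow> p / p * drop_ratio \<beta> (\<tau>2 \<mu> \<sigma>) p) (at_left p)"
    unfolding drop_ratio_def using p pos by (intro tendsto_intros) auto
  from robust_ratio_le_of_left_limit[OF _ a this]
  show "robust_ratio \<mu> \<beta> p \<sigma> \<le> drop_ratio \<beta> (\<tau>2 \<mu> \<sigma>) p"
    using bound(2) p by simp
qed

lemma robust_ratio_le_low:
  assumes p: "0 < p" and ups: "\<sigma>\<^sup>2 \<le> (\<mu> - p) * (\<beta> - \<mu>)"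
  shows "robust_ratio \<mu> \<beta> p \<sigma> \<le> p / partner \<mu> \<sigma> p"
    and "robust_ratio \<mu> \<beta> p \<sigma> \<le> cantelli \<mu> \<sigma> p"
proof -
  have d: "0 < \<beta> - \<mu>" using mean_less_\<tau>2[OF \<mu> \<sigma>] \<tau> by simp
  have "0 < (\<mu> - p) * (\<beta> - \<mu>)" using ups \<sigma> by (meson less_le_trans zero_less_power)
  then have p\<mu>: "p < \<mu>" using d by (simp add: zero_less_mult_iff)
  have bound: "robust_ratio \<mu> \<beta> p \<sigma> \<le> p / partner \<mu> \<sigma> x"
    "robust_ratio \<mu> \<beta> p \<sigma> \<le> p / x * cantelli \<mu> \<sigma> x" if x: "0 < x" "x < p" for x
  proof -
    define z where "z = partner \<mu> \<sigma> x"
    have x\<mu>: "x < \<mu>" using x p\<mu> by simp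
    have z\<mu>: "\<mu> < z" using partner_gt_mean[OF \<sigma> x\<mu>] by (simp add: z_def)
    have zm: "(\<mu> - x) * (z - \<mu>) = \<sigma>\<^sup>2" using partner_mult[OF x\<mu>] by (simp add: z_def)
    have "(\<mu> - x) * (z - \<mu>) \<le> (\<mu> - p) * (\<beta> - \<mu>)" using zm ups by simp
    also have "\<dots> \<le> (\<mu> - x) * (\<beta> - \<mu>)" using x d by (intro mult_right_mono) auto
    finally have z\<beta>: "z \<le> \<beta>" using x\<mu> by simp
    have "\<sigma>\<^sup>2 / \<mu> \<le> \<sigma>\<^sup>2 / (\<mu> - x)"
      using x x\<mu> \<mu> by (intro divide_left_mono) auto
    then have "\<tau>2 \<mu> \<sigma> \<le> z" by (simp add: \<tau>2_def z_def partner_def)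
    have "p \<le> z" "x < \<tau>2 \<mu> \<sigma>" "(\<mu> - x) * (z - \<mu>) \<le> \<sigma>\<^sup>2"
      using z\<mu> p\<mu> x\<mu> mean_less_\<tau>2[OF \<mu> \<sigma>] zm by auto
    note * = robust_ratio_le_three_point[OF x \<open>p \<le> z\<close> z\<beta> \<open>x < \<tau>2 \<mu> \<sigma>\<close> \<open>\<tau>2 \<mu> \<sigma> \<le> z\<close> this(3)]
    show "robust_ratio \<mu> \<beta> p \<sigma> \<le> p / partner \<mu> \<sigma> x" using *(1) by (simp add: z_def)
    show "robust_ratio \<mu> \<beta> p \<sigma> \<le> p / x * cantelli \<mu> \<sigma> x"
      using *(2) drop_ratio_partner[OF \<mu> \<sigma> x(1) x\<mu>] by (simp add: z_def)
  qed
  have "partner \<mu> \<sigma> p \<noteq> 0" using partner_gt_mean[OF \<sigma> p\<mu>] \<mu> by simp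
  then have "((\<lambda>x. p / partner \<mu> \<sigma> x) \<longlongrightarrow> p / partner \<mu> \<sigma> p) (at_left p)"
    unfolding partner_def using p\<mu> by (intro tendsto_intros) auto
  from robust_ratio_le_of_left_limit[OF bound(1) p this]
  show "robust_ratio \<mu> \<beta> p \<sigma> \<le> p / partner \<mu> \<sigma> p" .
  have "(\<mu> - p)\<^sup>2 + \<sigma>\<^sup>2 \<noteq> 0" using \<sigma> by (simp add: sum_power2_eq_zero_iff)
  then have "((\<lambda>x. p / x * cantelli \<mu> \<sigma> x) \<longlongrightarrow> p / p * cantelli \<mu> \<sigma> p) (at_left p)"
    unfolding cantelli_def using p by (intro tendsto_intros) auto
  from robust_ratio_le_of_left_limit[OF bound(2) p this]
  show "robust_ratio \<mu> \<beta> p \<sigma> \<le> cantelli \<mu> \<sigma> p" using p by simp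
qed

lemma two_point_distribution:
  obtains P where "P \<in> ambiguity_set \<mu> \<sigma> \<beta>" and "\<And>p. \<tau>2 \<mu> \<sigma> < p \<Longrightarrow> measure P {p..} = 0"
proof -
  define T where "T = \<tau>2 \<mu> \<sigma>"
  have T: "\<mu> < T" "T < \<beta>" using mean_less_\<tau>2[OF \<mu> \<sigma>] \<tau> by (auto simp: T_def)
  have "(\<mu> - T / 2) * (T - \<mu>) \<le> \<mu> * (T - \<mu>)" using T \<mu> by (intro mult_right_mono) auto
  also have "\<dots> = \<sigma>\<^sup>2" using \<mu> by (simp add: T_def \<tau>2_def)
  finally have w0: "(\<mu> - T / 2) * (T - \<mu>) \<le> \<sigma>\<^sup>2" .
  show thesis
  proof (rule three_point_distribution[OF \<mu> _ _ _ _ _ w0, of \<beta>])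
    fix P assume P: "P \<in> ambiguity_set \<mu> \<sigma> \<beta>"
      "\<And>t. 0 < t \<Longrightarrow> measure P {t..} =
        (if t \<le> T / 2 then \<mu> * (T - \<tau>2 \<mu> \<sigma>) / (T / 2 * (T - T / 2)) else 0) +
        (if t \<le> T then \<mu> * (\<tau>2 \<mu> \<sigma> - T / 2) / (T * (T - T / 2)) else 0)"
    show thesis
      by (rule that[OF P(1)]) (use P(2) T \<mu> in \<open>auto simp: T_def[symmetric]\<close>)
  qed (use T \<mu> in \<open>auto simp: T_def\<close>)
qed

text \<open>
  The upper bound holds in each regime with one of the two values, the lower bound
  in both regimes with both values. Prices above \<open>\<tau>2\<close> may never sell, because all the mass can
  lie on \<open>0\<close> and \<open>\<tau>2\<close>.
\<close>
lemma robust_ratio_eq: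
  assumes p: "0 < p"
  shows "robust_ratio \<mu> \<beta> p \<sigma> = max (low_value \<mu> \<sigma> p) (high_value \<beta> (\<tau>2 \<mu> \<sigma>) p)"
proof (rule antisym)
  obtain P where P: "P \<in> ambiguity_set \<mu> \<sigma> \<beta>" "\<tau>2 \<mu> \<sigma> < p \<Longrightarrow> measure P {p..} = 0"
    using two_point_distribution by blast
  show "max (low_value \<mu> \<sigma> p) (high_value \<beta> (\<tau>2 \<mu> \<sigma>) p) \<le> robust_ratio \<mu> \<beta> p \<sigma>"
    unfolding robust_ratio_def
    using P(1) low_value_le_CR high_value_le_CR p by (intro cINF_greatest) auto
  consider "\<sigma>\<^sup>2 \<le> (\<mu> - p) * (\<beta> - \<mu>)" | "(\<mu> - p) * (\<beta> - \<mu>) < \<sigma>\<^sup>2" "p < \<tau>2 \<mu> \<sigma>"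
    | "(\<mu> - p) * (\<beta> - \<mu>) < \<sigma>\<^sup>2" "p = \<tau>2 \<mu> \<sigma>" | "\<tau>2 \<mu> \<sigma> < p" by linarith
  then show "robust_ratio \<mu> \<beta> p \<sigma> \<le> max (low_value \<mu> \<sigma> p) (high_value \<beta> (\<tau>2 \<mu> \<sigma>) p)"
  proof cases
    case 1
    have "0 < (\<mu> - p) * (\<beta> - \<mu>)" using 1 \<sigma> by (meson less_le_trans zero_less_power)
    then have "p < \<mu>" using mean_less_\<tau>2[OF \<mu> \<sigma>] \<tau> by (simp add: zero_less_mult_iff)
    then show ?thesis using robust_ratio_le_low[OF p 1] by (simp add: low_value_def)
  next
    case 2
    then show ?thesis using robust_ratio_le_high[OF p _ 2(1)] by (auto simp: high_value_def)
  next
    case 3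
    then have "robust_ratio \<mu> \<beta> p \<sigma> \<le> 0"
      using robust_ratio_le_high(2)[OF p _ 3(1)] by (auto simp: drop_ratio_def)
    then show ?thesis using high_value_nonneg[OF p \<tau>] by linarith
  next
    case 4
    then have "robust_ratio \<mu> \<beta> p \<sigma> \<le> 0"
      using robust_ratio_le_CR[OF P(1) p] P(2) by (simp add: CR_def)
    then show ?thesis using high_value_nonneg[OF p \<tau>] by linarith
  qed
qed

end

section \<open>The maximum of the low value\<close>

lemma self_over_self_plus_mono:
  fixes a b c d :: real
  assumes "0 \<le> a" "a \<le> b" "0 < d" "d \<le> c"
  shows "a / (a + c) \<le> b / (b + d)"
proof -
  have "a * d \<le> b * c" using assms by (intro mult_mono) auto
  then show ?thesis using assms by (simp add: field_simps)
qed

lemma self_over_self_plus_strict_mono: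
  fixes a b c :: real
  assumes "0 \<le> a" "a < b" "0 < c"
  shows "a / (a + c) < b / (b + c)"
  using assms by (simp add: field_simps)

text \<open>
  The root of \<open>w ^ 3 + 2 * w = \<mu> / \<sigma>\<close>; up to the factor \<open>\<sigma>\<close> it is the distance of \<open>p_l\<close> from \<open>\<mu>\<close>.
\<close>
definition cardano :: "real \<Rightarrow> real \<Rightarrow> real" where
  "cardano \<mu> \<sigma> = root 3 (\<mu> / (2 * \<sigma>) + sqrt (8 / 27 + (\<mu> / (2 * \<sigma>))\<^sup>2)) +
     root 3 (\<mu> / (2 * \<sigma>) - sqrt (8 / 27 + (\<mu> / (2 * \<sigma>))\<^sup>2))"

lemma p_l_cardano: "p_l \<mu> \<sigma> = \<mu> - \<sigma> * cardano \<mu> \<sigma>"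
  by (simp add: p_l_def cardano_def)

text \<open>
  The two cube roots have product \<open>- 2 / 3\<close>, since the radicands multiply to \<open>- 8 / 27\<close>, and
  their cubes add up to \<open>\<mu> / \<sigma>\<close>; expand the cube of the sum.
\<close>
lemma cardano_cubic: "cardano \<mu> \<sigma> ^ 3 + 2 * cardano \<mu> \<sigma> = \<mu> / \<sigma>"
proof -
  define a where "a = \<mu> / (2 * \<sigma>)"
  define r where "r = sqrt (8 / 27 + a\<^sup>2)"
  define u v where "u = root 3 (a + r)" and "v = root 3 (a - r)"
  have r: "r\<^sup>2 = 8 / 27 + a\<^sup>2" by (simp add: r_def)
  have u: "u ^ 3 = a + r" and v: "v ^ 3 = a - r"
    by (simp_all add: u_def v_def odd_real_root_pow)
  have "u * v = root 3 ((a + r) * (a - r))" by (simp add: u_def v_def real_root_mult)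
  also have "(a + r) * (a - r) = (- 2 / 3) ^ 3"
    using r by (simp add: power2_eq_square power3_eq_cube algebra_simps)
  also have "root 3 ((- 2 / 3) ^ 3) = - 2 / 3" by (rule odd_real_root_power_cancel) simp
  finally have uv: "u * v = - 2 / 3" .
  have "(u + v) ^ 3 = u ^ 3 + v ^ 3 + 3 * (u * v) * (u + v)"
    by (simp add: power3_eq_cube algebra_simps)
  then have "(u + v) ^ 3 + 2 * (u + v) = 2 * a" unfolding uv u v by simp
  moreover have "cardano \<mu> \<sigma> = u + v" by (simp add: cardano_def u_def v_def r_def a_def)
  ultimately show ?thesis by (simp add: a_def)
qed

lemma cubic_le_iff:
  fixes x y :: real
  shows "x ^ 3 + 2 * x \<le> y ^ 3 + 2 * y \<longleftrightarrow> x \<le> y"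
proof -
  have mono: "a ^ 3 + 2 * a < b ^ 3 + 2 * b" if "a < b" for a b :: real
    using that power_mono_odd[of 3 a b] by simp
  show ?thesis using mono[of x y] mono[of y x] by (cases x y rule: linorder_cases) auto
qed

lemma cardano_pos:
  assumes "0 < \<mu>" "0 < \<sigma>"
  shows "0 < cardano \<mu> \<sigma>"
proof -
  have "\<mu> / \<sigma> \<le> 0 \<longleftrightarrow> cardano \<mu> \<sigma> \<le> 0"
    using cubic_le_iff[of "cardano \<mu> \<sigma>" 0] by (simp add: cardano_cubic)
  moreover have "0 < \<mu> / \<sigma>" using assms by simp
  ultimately show ?thesis by linarith
qed

lemma cardano_antimono:
  assumes "0 < \<mu>" "0 < \<sigma>" "\<sigma> < \<sigma>'"
  shows "cardano \<mu> \<sigma>' < cardano \<mu> \<sigma>"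
proof -
  have "\<mu> / \<sigma>' < \<mu> / \<sigma>" using assms by (simp add: frac_less2)
  then show ?thesis
    using cubic_le_iff[of "cardano \<mu> \<sigma>" "cardano \<mu> \<sigma>'"] by (simp add: cardano_cubic)
qed

lemma p_l_cubic:
  assumes "0 < \<sigma>"
  shows "(\<mu> - p_l \<mu> \<sigma>) ^ 3 + 2 * (\<mu> - p_l \<mu> \<sigma>) * \<sigma>\<^sup>2 = \<mu> * \<sigma>\<^sup>2"
proof -
  have "(\<sigma> * cardano \<mu> \<sigma>) ^ 3 + 2 * (\<sigma> * cardano \<mu> \<sigma>) * \<sigma>\<^sup>2 =
      \<sigma> ^ 3 * (cardano \<mu> \<sigma> ^ 3 + 2 * cardano \<mu> \<sigma>)"
    by (simp add: power2_eq_square power3_eq_cube algebra_simps)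
  also have "\<dots> = \<mu> * \<sigma>\<^sup>2"
    unfolding cardano_cubic using assms by (simp add: power2_eq_square power3_eq_cube)
  finally show ?thesis by (simp add: p_l_cardano)
qed

lemma
  assumes "0 < \<mu>" "0 < \<sigma>"
  shows p_l_less_mean: "p_l \<mu> \<sigma> < \<mu>" and p_l_pos: "0 < p_l \<mu> \<sigma>"
proof -
  define y where "y = \<mu> - p_l \<mu> \<sigma>"
  have y: "0 < y" using cardano_pos[OF assms] assms by (simp add: y_def p_l_cardano)
  then show "p_l \<mu> \<sigma> < \<mu>" by (simp add: y_def)
  have "2 * y * \<sigma>\<^sup>2 < \<mu> * \<sigma>\<^sup>2"
    using p_l_cubic[OF assms(2), of \<mu>] y unfolding y_def[symmetric]
    by (smt (verit) zero_less_power)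
  then have "2 * y < \<mu>" using assms by simp
  then show "0 < p_l \<mu> \<sigma>" using y by (simp add: y_def)
qed

lemma over_partner:
  assumes "p < \<mu>"
  shows "p / partner \<mu> \<sigma> p = p * (\<mu> - p) / (\<mu> * (\<mu> - p) + \<sigma>\<^sup>2)"
proof -
  have "partner \<mu> \<sigma> p = (\<mu> * (\<mu> - p) + \<sigma>\<^sup>2) / (\<mu> - p)"
    using assms by (simp add: partner_def add_divide_distrib)
  then show ?thesis by simp
qed

context
  fixes \<mu> \<sigma> :: real
  assumes \<mu>: "0 < \<mu>" and \<sigma>: "0 < \<sigma>"
begin

text \<open>
  The defining property of \<open>p_l\<close>: both attacks on the low side do equal damage. With
  \<open>y = \<mu> - p\<close> the equation of the two values is the cubic equation of \<open>p_l_cubic\<close>.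
\<close>
lemma p_l_over_partner: "p_l \<mu> \<sigma> / partner \<mu> \<sigma> (p_l \<mu> \<sigma>) = cantelli \<mu> \<sigma> (p_l \<mu> \<sigma>)"
proof -
  define y where "y = \<mu> - p_l \<mu> \<sigma>"
  have y: "0 < y" using p_l_less_mean[OF \<mu> \<sigma>] by (simp add: y_def)
  have cubic: "y ^ 3 + 2 * y * \<sigma>\<^sup>2 = \<mu> * \<sigma>\<^sup>2" using p_l_cubic[OF \<sigma>, of \<mu>] by (simp add: y_def)
  have "(\<mu> - y) * (y\<^sup>2 + \<sigma>\<^sup>2) = y * (\<mu> * y + \<sigma>\<^sup>2)"
    using cubic by (simp add: algebra_simps power2_eq_square power3_eq_cube)
  then have "(\<mu> - y) * y * (y\<^sup>2 + \<sigma>\<^sup>2) = y\<^sup>2 * (\<mu> * y + \<sigma>\<^sup>2)"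
    by (simp add: power2_eq_square)
  moreover have "0 < \<mu> * y + \<sigma>\<^sup>2" "0 < y\<^sup>2 + \<sigma>\<^sup>2" using \<mu> y \<sigma> by (simp_all add: add_pos_pos)
  ultimately have "(\<mu> - y) * y / (\<mu> * y + \<sigma>\<^sup>2) = y\<^sup>2 / (y\<^sup>2 + \<sigma>\<^sup>2)" by (subst frac_eq_eq) auto
  then show ?thesis
    using over_partner[OF p_l_less_mean[OF \<mu> \<sigma>]] by (simp add: y_def cantelli_def)
qed

lemma low_value_p_l: "low_value \<mu> \<sigma> (p_l \<mu> \<sigma>) = cantelli \<mu> \<sigma> (p_l \<mu> \<sigma>)"
  using p_l_less_mean[OF \<mu> \<sigma>] by (simp add: low_value_def p_l_over_partner)

lemma low_value_p_l_pos: "0 < low_value \<mu> \<sigma> (p_l \<mu> \<sigma>)"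
  unfolding low_value_p_l cantelli_def using p_l_less_mean[OF \<mu> \<sigma>] \<sigma> by (simp add: add_pos_pos)

text \<open>
  To the left of \<open>p_l\<close> the value \<open>p / partner\<close> is still strictly increasing, to the right of it
  the Cantelli bound strictly decreases; the minimum of the two is therefore smaller on either side.
\<close>
lemma low_value_less:
  assumes p: "0 < p" "p \<noteq> p_l \<mu> \<sigma>"
  shows "low_value \<mu> \<sigma> p < low_value \<mu> \<sigma> (p_l \<mu> \<sigma>)"
proof -
  define y where "y = \<mu> - p_l \<mu> \<sigma>"
  have y: "0 < y" "y < \<mu>"
    using p_l_less_mean[OF \<mu> \<sigma>] p_l_pos[OF \<mu> \<sigma>] by (auto simp: y_def)
  have cubic: "y ^ 3 + 2 * y * \<sigma>\<^sup>2 = \<mu> * \<sigma>\<^sup>2" using p_l_cubic[OF \<sigma>, of \<mu>] by (simp add: y_def)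
  consider "\<mu> \<le> p" | "p_l \<mu> \<sigma> < p" "p < \<mu>" | "p < p_l \<mu> \<sigma>" using p by linarith
  then show ?thesis
  proof cases
    case 1
    then show ?thesis using low_value_p_l_pos by (simp add: low_value_def)
  next
    case 2
    have "(\<mu> - p)\<^sup>2 < y\<^sup>2" using 2 by (intro power_strict_mono) (auto simp: y_def)
    then have "cantelli \<mu> \<sigma> p < cantelli \<mu> \<sigma> (p_l \<mu> \<sigma>)"
      unfolding cantelli_def y_def using \<sigma> by (intro self_over_self_plus_strict_mono) auto
    then show ?thesis using 2 by (simp add: low_value_p_l) (simp add: low_value_def)
  next
    case 3
    \<comment> \<open>Here \<open>w > y\<close>, and the cubic equation eliminates \<open>\<mu> * \<sigma>\<^sup>2\<close> from the sign of the difference.\<close>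
    define w where "w = \<mu> - p"
    have w: "y < w" "w < \<mu>" using 3 p by (auto simp: y_def w_def)
    have "\<sigma>\<^sup>2 * (\<mu> - w - y) < \<mu> * w * y"
    proof -
      have "\<sigma>\<^sup>2 * (\<mu> - w - y) = y ^ 3 - \<sigma>\<^sup>2 * (w - y)" using cubic by (simp add: algebra_simps)
      also have "\<dots> \<le> y ^ 3" using w by simp
      also have "\<dots> = y * y * y" by (simp add: power3_eq_cube)
      also have "\<dots> < \<mu> * w * y"
        using w y by (intro mult_strict_right_mono mult_strict_mono) auto
      finally show ?thesis .
    qed
    then have "0 < (w - y) * (\<mu> * w * y - \<sigma>\<^sup>2 * (\<mu> - w - y))" using w by simp
    also have "\<dots> = (\<mu> - y) * y * (\<mu> * w + \<sigma>\<^sup>2) - (\<mu> - w) * w * (\<mu> * y + \<sigma>\<^sup>2)"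
      by (simp add: algebra_simps)
    finally have "(\<mu> - w) * w * (\<mu> * y + \<sigma>\<^sup>2) < (\<mu> - y) * y * (\<mu> * w + \<sigma>\<^sup>2)" by simp
    moreover have "0 < \<mu> * w + \<sigma>\<^sup>2" "0 < \<mu> * y + \<sigma>\<^sup>2"
      using \<mu> w y \<sigma> by (simp_all add: add_pos_pos)
    ultimately have "(\<mu> - w) * w / (\<mu> * w + \<sigma>\<^sup>2) < (\<mu> - y) * y / (\<mu> * y + \<sigma>\<^sup>2)"
      by (simp add: divide_less_eq pos_less_divide_eq mult.commute)
    then have "p / partner \<mu> \<sigma> p < p_l \<mu> \<sigma> / partner \<mu> \<sigma> (p_l \<mu> \<sigma>)"
      using over_partner[of p] over_partner[of "p_l \<mu> \<sigma>"] p_l_less_mean[OF \<mu> \<sigma>] 3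
      by (simp add: w_def y_def)
    then show ?thesis using 3 p_l_less_mean[OF \<mu> \<sigma>]
      by (simp add: low_value_p_l p_l_over_partner) (simp add: low_value_def)
  qed
qed

lemma low_value_le: "0 < p \<Longrightarrow> low_value \<mu> \<sigma> p \<le> low_value \<mu> \<sigma> (p_l \<mu> \<sigma>)"
  using low_value_less by (cases "p = p_l \<mu> \<sigma>") (auto simp: less_imp_le)

lemma low_value_p_l_cardano:
  "low_value \<mu> \<sigma> (p_l \<mu> \<sigma>) = (cardano \<mu> \<sigma>)\<^sup>2 / ((cardano \<mu> \<sigma>)\<^sup>2 + 1)"
proof -
  have "low_value \<mu> \<sigma> (p_l \<mu> \<sigma>) =
      (\<sigma>\<^sup>2 * (cardano \<mu> \<sigma>)\<^sup>2) / (\<sigma>\<^sup>2 * ((cardano \<mu> \<sigma>)\<^sup>2 + 1))"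
    unfolding low_value_p_l by (simp add: cantelli_def p_l_cardano power_mult_distrib distrib_left)
  also have "\<dots> = (cardano \<mu> \<sigma>)\<^sup>2 / ((cardano \<mu> \<sigma>)\<^sup>2 + 1)"
    using \<sigma> by (subst mult_divide_mult_cancel_left) auto
  finally show ?thesis .
qed

end

text \<open>
  The value at \<open>p_l\<close> depends on \<open>\<mu>\<close> and \<open>\<sigma>\<close> only through the Cardano root, and that root
  decreases when \<open>\<sigma>\<close> grows.
\<close>
lemma low_value_p_l_antimono:
  assumes "0 < \<mu>" "0 < \<sigma>" "\<sigma> < \<sigma>'"
  shows "low_value \<mu> \<sigma>' (p_l \<mu> \<sigma>') < low_value \<mu> \<sigma> (p_l \<mu> \<sigma>)"
proof -
  have "0 < cardano \<mu> \<sigma>'" using assms by (intro cardano_pos) auto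
  then have "(cardano \<mu> \<sigma>')\<^sup>2 < (cardano \<mu> \<sigma>)\<^sup>2"
    using cardano_antimono[OF assms] by (intro power_strict_mono) auto
  then show ?thesis using assms
    by (simp add: low_value_p_l_cardano self_over_self_plus_strict_mono)
qed

section \<open>The maximum of the high value\<close>

text \<open>
  The smaller root of \<open>p\<^sup>2 - (\<beta> + T) * p + \<beta> * (2 * T - \<beta>)\<close>, which is the condition for
  \<open>p / \<beta>\<close> and \<open>drop_ratio \<beta> T p\<close> to agree. The larger root exceeds \<open>T\<close>. For \<open>2 * T < \<beta>\<close> the
  crossing is negative, and \<open>drop_ratio\<close> is the smaller value at every positive price below \<open>T\<close>.
\<close>
definition crossing :: "real \<Rightarrow> real \<Rightarrow> real" where
  "crossing \<beta> T = 1 / 2 * (\<beta> + T - sqrt ((3 * \<beta> - T)\<^sup>2 - 4 * \<beta>\<^sup>2))"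

definition high_peak :: "real \<Rightarrow> real \<Rightarrow> real" where
  "high_peak \<beta> T = max (crossing \<beta> T) (T / 2)"

lemma p_h_eq_high_peak: "p_h \<mu> \<sigma> \<beta> = high_peak \<beta> (\<tau>2 \<mu> \<sigma>)"
  by (simp add: p_h_def p_h1_def p_h2_def high_peak_def crossing_def)

context
  fixes \<beta> T :: real
  assumes T: "0 < T" "T < \<beta>"
begin

lemma drop_ratio_less:
  assumes "0 \<le> p * (T - p)" "p * (T - p) < q * (T - q)"
  shows "drop_ratio \<beta> T p < drop_ratio \<beta> T q"
  unfolding drop_ratio_def using assms T by (intro self_over_self_plus_strict_mono) auto

lemma crossing_less: "crossing \<beta> T < T"
proof -
  have "(3 * \<beta> - T)\<^sup>2 - 4 * \<beta>\<^sup>2 - (\<beta> - T)\<^sup>2 = 4 * \<beta> * (\<beta> - T)"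
    by (simp add: power2_eq_square algebra_simps)
  moreover have "0 < 4 * \<beta> * (\<beta> - T)" using T by simp
  ultimately have "(\<beta> - T)\<^sup>2 < (3 * \<beta> - T)\<^sup>2 - 4 * \<beta>\<^sup>2" by linarith
  then have "\<beta> - T < sqrt ((3 * \<beta> - T)\<^sup>2 - 4 * \<beta>\<^sup>2)" by (rule real_less_rsqrt)
  then show ?thesis by (simp add: crossing_def)
qed

lemma drop_ratio_minus_linear:
  assumes p: "0 < p" "p < T"
  obtains k where "0 < k" "p / \<beta> - drop_ratio \<beta> T p = k * (p - crossing \<beta> T)"
proof -
  define D where "D = (3 * \<beta> - T)\<^sup>2 - 4 * \<beta>\<^sup>2"
  define q where "q = sqrt D"
  define r where "r = 1 / 2 * (\<beta> + T + q)"
  have cr: "crossing \<beta> T = 1 / 2 * (\<beta> + T - q)" by (simp add: crossing_def q_def D_def)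
  define N where "N = p * (T - p) + \<beta> * (\<beta> - T)"
  have N: "0 < N" using p T by (simp add: N_def add_pos_pos)
  have "D = (5 * \<beta> - T) * (\<beta> - T)" by (simp add: D_def power2_eq_square algebra_simps)
  then have "0 \<le> D" using T by simp
  then have q: "0 \<le> q" "q\<^sup>2 = D" by (auto simp: q_def)
  then have r: "p < r" using p T by (simp add: r_def)
  have "(p - crossing \<beta> T) * (r - p) = (q\<^sup>2 - (\<beta> + T - 2 * p)\<^sup>2) / 4"
    by (simp add: cr r_def power2_eq_square field_simps)
  also have "\<dots> = N - \<beta> * (T - p)"
    unfolding q by (simp add: D_def N_def power2_eq_square field_simps)
  finally have factor: "N - \<beta> * (T - p) = (p - crossing \<beta> T) * (r - p)" by simp
  have "p / \<beta> - drop_ratio \<beta> T p = p * (N - \<beta> * (T - p)) / (\<beta> * N)"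
    using N T unfolding drop_ratio_def N_def[symmetric] by (simp add: field_simps)
  also have "\<dots> = p * (r - p) / (\<beta> * N) * (p - crossing \<beta> T)" unfolding factor by simp
  finally have "p / \<beta> - drop_ratio \<beta> T p = p * (r - p) / (\<beta> * N) * (p - crossing \<beta> T)" .
  moreover have "0 < p * (r - p) / (\<beta> * N)" using p r N T by simp
  ultimately show thesis using that by blast
qed

lemma
  assumes p: "0 < p" "p < T"
  shows drop_ratio_le_iff: "drop_ratio \<beta> T p \<le> p / \<beta> \<longleftrightarrow> crossing \<beta> T \<le> p"
    and drop_ratio_ge_iff: "p / \<beta> \<le> drop_ratio \<beta> T p \<longleftrightarrow> p \<le> crossing \<beta> T"
proof -
  obtain k where k: "0 < k" "p / \<beta> - drop_ratio \<beta> T p = k * (p - crossing \<beta> T)"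
    by (rule drop_ratio_minus_linear[OF p])
  have "drop_ratio \<beta> T p \<le> p / \<beta> \<longleftrightarrow> 0 \<le> k * (p - crossing \<beta> T)" using k(2) by linarith
  then show "drop_ratio \<beta> T p \<le> p / \<beta> \<longleftrightarrow> crossing \<beta> T \<le> p"
    using k(1) by (simp add: zero_le_mult_iff)
  have "p / \<beta> \<le> drop_ratio \<beta> T p \<longleftrightarrow> k * (p - crossing \<beta> T) \<le> 0" using k(2) by linarith
  then show "p / \<beta> \<le> drop_ratio \<beta> T p \<longleftrightarrow> p \<le> crossing \<beta> T"
    using k(1) by (simp add: mult_le_0_iff)
qed

lemma high_peak_bounds: "0 < high_peak \<beta> T" "high_peak \<beta> T < T"
  using T crossing_less by (auto simp: high_peak_def)

lemma high_value_high_peak: "high_value \<beta> T (high_peak \<beta> T) = drop_ratio \<beta> T (high_peak \<beta> T)"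
  using drop_ratio_le_iff[OF high_peak_bounds] high_peak_bounds
  by (auto simp: high_value_def high_peak_def)

lemma high_value_high_peak_pos: "0 < high_value \<beta> T (high_peak \<beta> T)"
  unfolding high_value_high_peak drop_ratio_def using high_peak_bounds T by (simp add: add_pos_pos)

text \<open>
  If the crossing comes before \<open>T / 2\<close>, the peak of \<open>drop_ratio\<close> at \<open>T / 2\<close> decides; otherwise the
  increasing value \<open>p / \<beta>\<close> bounds the ratio before the crossing and the decreasing
  \<open>drop_ratio\<close> after it.
\<close>
lemma high_value_less:
  assumes p: "0 < p" "p \<noteq> high_peak \<beta> T"
  shows "high_value \<beta> T p < high_value \<beta> T (high_peak \<beta> T)"
proof -
  define h where "h = high_peak \<beta> T"
  have h: "0 < h" "h < T" using high_peak_bounds by (auto simp: h_def)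
  have quad: "h * (T - h) - p * (T - p) = (p - h) * (p + h - T)"
    by (simp add: algebra_simps)
  have "T \<le> p \<or> p < T \<and> 0 < (p - h) * (p + h - T) \<or> p < h \<and> crossing \<beta> T = h"
    using p unfolding h_def[symmetric]
    by (cases "p < h"; cases "crossing \<beta> T \<le> T / 2")
      (auto simp: h_def high_peak_def zero_less_mult_iff)
  then consider "T \<le> p" | "p < T" "0 < (p - h) * (p + h - T)" | "p < h" "crossing \<beta> T = h"
    by blast
  then show ?thesis
  proof cases
    case 1
    then show ?thesis using high_value_high_peak_pos by (simp add: high_value_def)
  next
    case 2
    have "drop_ratio \<beta> T p < drop_ratio \<beta> T h"
      using 2 quad p by (intro drop_ratio_less) auto
    then show ?thesis using 2 by (simp add: high_value_high_peak h_def) (simp add: high_value_def)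
  next
    case 3
    then have "p / \<beta> < h / \<beta>" using T by (simp add: divide_strict_right_mono)
    moreover have "h / \<beta> \<le> drop_ratio \<beta> T h" using drop_ratio_ge_iff[OF h] 3 by simp
    ultimately show ?thesis using 3 h
      by (simp add: high_value_high_peak h_def[symmetric]) (simp add: high_value_def)
  qed
qed

lemma high_value_le: "0 < p \<Longrightarrow> high_value \<beta> T p \<le> high_value \<beta> T (high_peak \<beta> T)"
  using high_value_less by (cases "p = high_peak \<beta> T") (auto simp: less_imp_le)

end

text \<open>
  A larger \<open>T\<close> requires more mass at \<open>\<beta>\<close>, so the drop in sales just above \<open>p\<close> becomes milder.
\<close>
lemma high_value_mono:
  assumes "0 < p" "T \<le> T'" "T' < \<beta>" "0 < T"
  shows "high_value \<beta> T p \<le> high_value \<beta> T' p"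
proof (cases "p < T")
  case True
  have "drop_ratio \<beta> T p \<le> drop_ratio \<beta> T' p"
    unfolding drop_ratio_def using assms True by (intro self_over_self_plus_mono) auto
  then show ?thesis using True assms by (auto simp: high_value_def)
next
  case False
  then show ?thesis using assms by (simp add: high_value_def drop_ratio_def)
qed

lemma high_peak_value_mono:
  assumes "0 < T" "T \<le> T'" "T' < \<beta>"
  shows "high_value \<beta> T (high_peak \<beta> T) \<le> high_value \<beta> T' (high_peak \<beta> T')"
proof -
  have h: "0 < high_peak \<beta> T" using assms by (intro high_peak_bounds) auto
  have "high_value \<beta> T (high_peak \<beta> T) \<le> high_value \<beta> T' (high_peak \<beta> T)"
    by (rule high_value_mono) (use assms h in auto)
  also have "\<dots> \<le> high_value \<beta> T' (high_peak \<beta> T')"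
    by (rule high_value_le) (use assms h in auto)
  finally show ?thesis .
qed

lemma \<tau>2_strict_mono:
  assumes "0 < \<mu>" "0 < \<sigma>" "\<sigma> < \<sigma>'"
  shows "\<tau>2 \<mu> \<sigma> < \<tau>2 \<mu> \<sigma>'"
  using assms power_strict_mono[of \<sigma> \<sigma>' 2] by (simp add: \<tau>2_def divide_strict_right_mono)

section \<open>Comparison of the two candidates\<close>

context
  fixes \<mu> \<sigma> \<beta> :: real
  assumes \<mu>: "0 < \<mu>" and \<sigma>: "0 < \<sigma>" and \<tau>: "\<tau>2 \<mu> \<sigma> < \<beta>"
begin

text \<open>
  In the low regime the partner of \<open>p\<close> does not exceed \<open>\<beta>\<close>, which settles the first attack. For
  the second one, clearing denominators turns the claim into the nonnegativity of the product
  \<open>(y * d - \<sigma>\<^sup>2) * (y * \<beta> * \<mu> + \<sigma>\<^sup>2 * p)\<close>, with \<open>y = \<mu> - p\<close> and \<open>d = \<beta> - \<mu>\<close>, and its first factor is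
  nonnegative exactly in that regime.
\<close>
lemma high_value_le_low_value:
  assumes p: "0 < p" and ups: "\<sigma>\<^sup>2 \<le> (\<mu> - p) * (\<beta> - \<mu>)"
  shows "high_value \<beta> (\<tau>2 \<mu> \<sigma>) p \<le> low_value \<mu> \<sigma> p"
proof -
  define T where "T = \<tau>2 \<mu> \<sigma>"
  define y d where "y = \<mu> - p" and "d = \<beta> - \<mu>"
  have T: "\<mu> < T" "T < \<beta>" using mean_less_\<tau>2[OF \<mu> \<sigma>] \<tau> by (auto simp: T_def)
  have \<mu>T: "\<mu> * T = \<mu>\<^sup>2 + \<sigma>\<^sup>2" using mean_times_\<tau>2[OF \<mu>] by (simp add: T_def)
  have d: "0 < d" using T by (simp add: d_def)
  have "0 < y * d" using ups \<sigma> unfolding y_def d_def by (meson less_le_trans zero_less_power)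
  then have y: "0 < y" using d by (simp add: zero_less_mult_iff)
  have p\<mu>: "p < \<mu>" using y by (simp add: y_def)
  have "\<sigma>\<^sup>2 / y \<le> d" using ups y by (simp add: y_def d_def divide_le_eq mult.commute)
  then have "partner \<mu> \<sigma> p \<le> \<beta>" by (simp add: partner_def y_def d_def)
  then have 1: "p / \<beta> \<le> p / partner \<mu> \<sigma> p"
    using partner_gt_mean[OF \<sigma> p\<mu>] \<mu> p T by (intro divide_left_mono) auto
  have "0 \<le> (y * d - \<sigma>\<^sup>2) * (y * \<beta> * \<mu> + \<sigma>\<^sup>2 * p)"
    using ups y \<mu> p T by (intro mult_nonneg_nonneg add_nonneg_nonneg) (auto simp: y_def d_def)
  also have "\<dots> = y\<^sup>2 * (\<beta> * (\<beta> * \<mu> - (\<mu>\<^sup>2 + \<sigma>\<^sup>2))) - \<sigma>\<^sup>2 * (p * ((\<mu>\<^sup>2 + \<sigma>\<^sup>2) - p * \<mu>))"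
    by (simp add: y_def d_def algebra_simps power2_eq_square)
  also have "\<dots> = \<mu> * (y\<^sup>2 * (\<beta> * (\<beta> - T)) - \<sigma>\<^sup>2 * (p * (T - p)))"
    unfolding \<mu>T[symmetric] by (simp add: algebra_simps)
  finally have "\<sigma>\<^sup>2 * (p * (T - p)) \<le> y\<^sup>2 * (\<beta> * (\<beta> - T))"
    using \<mu> by (simp add: zero_le_mult_iff)
  then have "p * (T - p) * (y\<^sup>2 + \<sigma>\<^sup>2) \<le> y\<^sup>2 * (p * (T - p) + \<beta> * (\<beta> - T))"
    by (simp add: algebra_simps)
  moreover have "0 < p * (T - p) + \<beta> * (\<beta> - T)" "0 < y\<^sup>2 + \<sigma>\<^sup>2"
    using p p\<mu> T \<mu> \<sigma> y by (simp_all add: add_pos_pos)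
  ultimately have 2: "drop_ratio \<beta> T p \<le> cantelli \<mu> \<sigma> p"
    unfolding drop_ratio_def cantelli_def y_def[symmetric]
    by (simp add: pos_divide_le_eq pos_le_divide_eq mult.commute)
  show ?thesis using 1 2 p\<mu> T by (auto simp: low_value_def high_value_def T_def[symmetric])
qed

text \<open>
  If \<open>p_l\<close> lies in the high regime, then \<open>p / \<beta> < drop_ratio\<close> holds there. At the boundary of the
  regimes both attacks have the same value at \<open>p_l\<close>, so \<open>s - y * d\<close> divides the difference of the
  two sides modulo the cubic equation for \<open>y\<close>; the remaining factor is positive.
\<close>
lemma p_l_less_crossing:
  assumes "(\<mu> - p_l \<mu> \<sigma>) * (\<beta> - \<mu>) < \<sigma>\<^sup>2"
  shows "p_l \<mu> \<sigma> < crossing \<beta> (\<tau>2 \<mu> \<sigma>)"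
proof -
  define T where "T = \<tau>2 \<mu> \<sigma>"
  define p where "p = p_l \<mu> \<sigma>"
  define y d s where "y = \<mu> - p" and "d = \<beta> - \<mu>" and "s = \<sigma>\<^sup>2"
  have T: "\<mu> < T" "T < \<beta>" using mean_less_\<tau>2[OF \<mu> \<sigma>] \<tau> by (auto simp: T_def)
  have \<mu>T: "\<mu> * T = \<mu>\<^sup>2 + s" using mean_times_\<tau>2[OF \<mu>] by (simp add: T_def s_def)
  have p: "0 < p" "p < \<mu>" using p_l_pos[OF \<mu> \<sigma>] p_l_less_mean[OF \<mu> \<sigma>] by (auto simp: p_def)
  have y: "0 < y" "y < \<mu>" using p by (auto simp: y_def)
  have cubic: "y ^ 3 + 2 * y * s = \<mu> * s"
    using p_l_cubic[OF \<sigma>, of \<mu>] by (simp add: y_def p_def s_def)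
  have "y * (\<mu> * ((\<beta> - p) * (T - p) - \<beta> * (\<beta> - T))) =
      y * ((\<beta> - p) * (\<mu> * T - p * \<mu>) - \<beta> * (\<beta> * \<mu> - \<mu> * T))" by (simp add: algebra_simps)
  also have "\<dots> = y * ((y + d) * (s + \<mu> * y) - (\<mu> + d) * (\<mu> * d - s))"
    unfolding \<mu>T by (simp add: y_def d_def algebra_simps power2_eq_square)
  also have "\<dots> = (s - y * d) * (\<mu> * d + (y\<^sup>2 + \<mu> * (\<mu> - y))) +
     (\<mu> + d) * (y ^ 3 + 2 * y * s - \<mu> * s)"
    by (simp add: algebra_simps power2_eq_square power3_eq_cube)
  finally have eq: "y * (\<mu> * ((\<beta> - p) * (T - p) - \<beta> * (\<beta> - T))) =
    (s - y * d) * (\<mu> * d + (y\<^sup>2 + \<mu> * (\<mu> - y))) + (\<mu> + d) * (y ^ 3 + 2 * y * s - \<mu> * s)" .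
  have "0 < (s - y * d) * (\<mu> * d + (y\<^sup>2 + \<mu> * (\<mu> - y)))"
  proof (rule mult_pos_pos)
    show "0 < s - y * d" using assms by (simp add: s_def y_def d_def p_def)
    show "0 < \<mu> * d + (y\<^sup>2 + \<mu> * (\<mu> - y))"
      using \<mu> y T by (intro add_pos_pos mult_pos_pos) (auto simp: d_def)
  qed
  then have "0 < y * (\<mu> * ((\<beta> - p) * (T - p) - \<beta> * (\<beta> - T)))" unfolding eq cubic by simp
  then have "\<beta> * (\<beta> - T) < (\<beta> - p) * (T - p)" using y \<mu> by (simp add: zero_less_mult_iff)
  then have "p * (T - p) + \<beta> * (\<beta> - T) < \<beta> * (T - p)" by (simp add: algebra_simps)
  then have "p * (p * (T - p) + \<beta> * (\<beta> - T)) < p * (\<beta> * (T - p))"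
    using p by (intro mult_strict_left_mono) auto
  moreover have "0 < p * (T - p) + \<beta> * (\<beta> - T)" using p T \<mu> by (simp add: add_pos_pos)
  ultimately have "p / \<beta> < drop_ratio \<beta> T p"
    unfolding drop_ratio_def using T \<mu> by (simp add: divide_less_eq pos_less_divide_eq mult_ac)
  moreover have "0 < T" "p < T" using T p by auto
  ultimately show ?thesis
    using drop_ratio_le_iff[OF \<open>0 < T\<close> T(2) p(1) \<open>p < T\<close>] by (simp add: T_def p_def)
qed

text \<open>
  The two candidates can coincide only in the low regime: \<open>p_h\<close> is never below the crossing, but
  in the high regime \<open>p_l\<close> is.
\<close>
lemma candidates_coincide:
  assumes "p_l \<mu> \<sigma> = p_h \<mu> \<sigma> \<beta>"
  shows "high_value \<beta> (\<tau>2 \<mu> \<sigma>) (p_h \<mu> \<sigma> \<beta>) \<le> low_value \<mu> \<sigma> (p_l \<mu> \<sigma>)"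
proof -
  have "crossing \<beta> (\<tau>2 \<mu> \<sigma>) \<le> p_l \<mu> \<sigma>"
    unfolding assms by (simp add: p_h_eq_high_peak high_peak_def)
  then have "\<sigma>\<^sup>2 \<le> (\<mu> - p_l \<mu> \<sigma>) * (\<beta> - \<mu>)" using p_l_less_crossing by (meson not_le)
  then show ?thesis
    using high_value_le_low_value p_l_pos[OF \<mu> \<sigma>] assms[symmetric] by simp
qed

lemma p_h_pos: "0 < p_h \<mu> \<sigma> \<beta>"
  unfolding p_h_eq_high_peak using mean_less_\<tau>2[OF \<mu> \<sigma>] \<mu> \<tau> by (intro high_peak_bounds) auto

lemma high_value_le_p_h:
  assumes "0 < p"
  shows "high_value \<beta> (\<tau>2 \<mu> \<sigma>) p \<le> high_value \<beta> (\<tau>2 \<mu> \<sigma>) (p_h \<mu> \<sigma> \<beta>)"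
  unfolding p_h_eq_high_peak using assms mean_less_\<tau>2[OF \<mu> \<sigma>] \<mu> \<tau> by (intro high_value_le) auto

lemma high_value_less_p_h:
  assumes "0 < p" "p \<noteq> p_h \<mu> \<sigma> \<beta>"
  shows "high_value \<beta> (\<tau>2 \<mu> \<sigma>) p < high_value \<beta> (\<tau>2 \<mu> \<sigma>) (p_h \<mu> \<sigma> \<beta>)"
  using assms mean_less_\<tau>2[OF \<mu> \<sigma>] \<mu> \<tau>
  unfolding p_h_eq_high_peak by (intro high_value_less) auto

lemma optimal_prices_eq:
  "optimal_prices \<mu> \<sigma> \<beta> = {p. 0 < p \<and>
     max (low_value \<mu> \<sigma> (p_l \<mu> \<sigma>)) (high_value \<beta> (\<tau>2 \<mu> \<sigma>) (p_h \<mu> \<sigma> \<beta>))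
     \<le> max (low_value \<mu> \<sigma> p) (high_value \<beta> (\<tau>2 \<mu> \<sigma>) p)}" (is "_ = {p. 0 < p \<and> ?M \<le> ?R p}")
proof -
  have R: "robust_ratio \<mu> \<beta> p \<sigma> = ?R p" if "0 < p" for p
    using robust_ratio_eq[OF \<mu> \<sigma> \<tau> that] .
  have pos: "0 < p_l \<mu> \<sigma>" "0 < p_h \<mu> \<sigma> \<beta>" using p_l_pos[OF \<mu> \<sigma>] p_h_pos by auto
  have ub: "?R p \<le> ?M" if "0 < p" for p
    using low_value_le[OF \<mu> \<sigma> that] high_value_le_p_h[OF that] by (rule max.mono)
  have att: "?M \<le> ?R (p_l \<mu> \<sigma>) \<or> ?M \<le> ?R (p_h \<mu> \<sigma> \<beta>)" by linarith
  have "is_arg_max (\<lambda>p. robust_ratio \<mu> \<beta> p \<sigma>) (\<lambda>p. 0 < p) p \<longleftrightarrow> 0 < p \<and> ?M \<le> ?R p" for p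
  proof
    assume max: "is_arg_max (\<lambda>p. robust_ratio \<mu> \<beta> p \<sigma>) (\<lambda>p. 0 < p) p"
    then have p: "0 < p" and ge: "\<And>q. 0 < q \<Longrightarrow> ?R q \<le> ?R p"
      unfolding is_arg_max_def by (metis, metis R not_less)
    show "0 < p \<and> ?M \<le> ?R p" using p att ge[OF pos(1)] ge[OF pos(2)] by linarith
  next
    assume "0 < p \<and> ?M \<le> ?R p"
    then show "is_arg_max (\<lambda>p. robust_ratio \<mu> \<beta> p \<sigma>) (\<lambda>p. 0 < p) p"
      unfolding is_arg_max_def using R ub by (metis not_less order.trans)
  qed
  then show ?thesis by (simp add: optimal_prices_def)
qed

text \<open>
  Each value attains its maximum at a single price, so the pointwise maximum of the two can attain
  the larger of the two maxima only there. For the same reason equal robust ratios of the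
  candidates force them to coincide unless \<open>L = H\<close>.
\<close>
lemma
  defines "L \<equiv> low_value \<mu> \<sigma> (p_l \<mu> \<sigma>)"
    and "H \<equiv> high_value \<beta> (\<tau>2 \<mu> \<sigma>) (p_h \<mu> \<sigma> \<beta>)"
  shows optimal_prices_low: "H < L \<Longrightarrow> optimal_prices \<mu> \<sigma> \<beta> = {p_l \<mu> \<sigma>}"
    and optimal_prices_tie: "L = H \<Longrightarrow> optimal_prices \<mu> \<sigma> \<beta> = {p_l \<mu> \<sigma>, p_h \<mu> \<sigma> \<beta>}"
    and optimal_prices_high: "L < H \<Longrightarrow> optimal_prices \<mu> \<sigma> \<beta> = {p_h \<mu> \<sigma> \<beta>}"
    and threshold_eq_low: "H < L \<Longrightarrow> threshold_eq \<mu> \<beta> \<sigma> \<Longrightarrow> p_l \<mu> \<sigma> = p_h \<mu> \<sigma> \<beta>"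
    and threshold_eq_tie: "L = H \<Longrightarrow> threshold_eq \<mu> \<beta> \<sigma>"
    and threshold_eq_high: "L < H \<Longrightarrow> \<not> threshold_eq \<mu> \<beta> \<sigma>"
proof -
  have pos: "0 < p_l \<mu> \<sigma>" "0 < p_h \<mu> \<sigma> \<beta>" using p_l_pos[OF \<mu> \<sigma>] p_h_pos by auto
  have l: "low_value \<mu> \<sigma> p \<le> L" "low_value \<mu> \<sigma> p = L \<longleftrightarrow> p = p_l \<mu> \<sigma>" if "0 < p" for p
    using low_value_le[OF \<mu> \<sigma> that] low_value_less[OF \<mu> \<sigma> that] by (force simp: L_def)+
  have h: "high_value \<beta> (\<tau>2 \<mu> \<sigma>) p \<le> H" "high_value \<beta> (\<tau>2 \<mu> \<sigma>) p = H \<longleftrightarrow> p = p_h \<mu> \<sigma> \<beta>"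
    if "0 < p" for p
    using high_value_le_p_h[OF that] high_value_less_p_h[OF that] by (force simp: H_def)+
  have O: "p \<in> optimal_prices \<mu> \<sigma> \<beta> \<longleftrightarrow>
      0 < p \<and> (low_value \<mu> \<sigma> p = max L H \<or> high_value \<beta> (\<tau>2 \<mu> \<sigma>) p = max L H)" for p
    using l(1)[of p] h(1)[of p] unfolding optimal_prices_eq L_def[symmetric] H_def[symmetric]
    by auto
  show "optimal_prices \<mu> \<sigma> \<beta> = {p_l \<mu> \<sigma>}" if "H < L"
    using that pos l h O by (intro set_eqI) (force simp: max_def)
  show "optimal_prices \<mu> \<sigma> \<beta> = {p_l \<mu> \<sigma>, p_h \<mu> \<sigma> \<beta>}" if "L = H"
    using that pos l(2) h(2) O by (intro set_eqI) auto
  show "optimal_prices \<mu> \<sigma> \<beta> = {p_h \<mu> \<sigma> \<beta>}" if "L < H"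
    using that pos l h O by (intro set_eqI) (force simp: max_def)
  have eq: "threshold_eq \<mu> \<beta> \<sigma> \<longleftrightarrow>
      max L (high_value \<beta> (\<tau>2 \<mu> \<sigma>) (p_l \<mu> \<sigma>)) = max (low_value \<mu> \<sigma> (p_h \<mu> \<sigma> \<beta>)) H"
    using robust_ratio_eq[OF \<mu> \<sigma> \<tau> pos(1)] robust_ratio_eq[OF \<mu> \<sigma> \<tau> pos(2)] \<sigma> \<tau>
    by (simp add: threshold_eq_def L_def H_def)
  note lh = l[OF pos(2)] h[OF pos(1)]
  show "p_l \<mu> \<sigma> = p_h \<mu> \<sigma> \<beta>" if "H < L" "threshold_eq \<mu> \<beta> \<sigma>"
  proof -
    have "low_value \<mu> \<sigma> (p_h \<mu> \<sigma> \<beta>) = L" using that eq lh(1,3) by linarith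
    then show ?thesis using lh(2) by simp
  qed
  show "threshold_eq \<mu> \<beta> \<sigma>" if "L = H"
    using that eq lh(1,3) by simp
  show "\<not> threshold_eq \<mu> \<beta> \<sigma>" if "L < H"
  proof
    assume "threshold_eq \<mu> \<beta> \<sigma>"
    then have "high_value \<beta> (\<tau>2 \<mu> \<sigma>) (p_l \<mu> \<sigma>) = H" using that eq lh(1,3) by linarith
    then have "p_l \<mu> \<sigma> = p_h \<mu> \<sigma> \<beta>" using lh(4) by simp
    then show False using candidates_coincide that by (simp add: L_def H_def)
  qed
qed

end

section \<open>The threshold\<close>

text \<open>
  For small \<open>\<sigma>\<close> the high value is at most \<open>\<tau>2 / \<beta>\<close>, hence at most a number \<open>k < 1\<close>, whereas the
  Cardano root grows beyond all bounds and drives the low value to \<open>1\<close>.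
\<close>
lemma low_dominates_near_zero:
  assumes \<mu>: "0 < \<mu>" "\<mu> < \<beta>"
  obtains \<sigma> where "0 < \<sigma>" "\<tau>2 \<mu> \<sigma> < \<beta>"
    "high_value \<beta> (\<tau>2 \<mu> \<sigma>) (p_h \<mu> \<sigma> \<beta>) < low_value \<mu> \<sigma> (p_l \<mu> \<sigma>)"
proof -
  define k where "k = (\<mu> + \<beta>) / (2 * \<beta>)"
  have k: "0 < k" "k < 1" using \<mu> by (auto simp: k_def)
  \<comment> \<open>Any \<open>K\<close> with \<open>K\<^sup>2 / (K\<^sup>2 + 1) > k\<close> serves as a lower bound for the Cardano root.\<close>
  define K where "K = 1 / (1 - k)"
  have K: "1 < K" using k by (simp add: K_def)
  \<comment> \<open>The first bound keeps \<open>\<tau>2\<close> below \<open>(\<mu> + \<beta>) / 2\<close>, the second keeps the Cardano root above \<open>K\<close>.\<close>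
  define \<sigma> where "\<sigma> = min (sqrt (\<mu> * (\<beta> - \<mu>) / 2)) (\<mu> / (K ^ 3 + 2 * K))"
  have K3: "0 < K ^ 3 + 2 * K" using K by (simp add: add_pos_pos)
  then have \<sigma>: "0 < \<sigma>" using \<mu> by (simp add: \<sigma>_def)
  have "\<sigma>\<^sup>2 \<le> (sqrt (\<mu> * (\<beta> - \<mu>) / 2))\<^sup>2" using \<sigma> by (intro power_mono) (auto simp: \<sigma>_def)
  then have "\<sigma>\<^sup>2 \<le> \<mu> * (\<beta> - \<mu>) / 2" using \<mu> by simp
  then have "\<sigma>\<^sup>2 / \<mu> \<le> (\<beta> - \<mu>) / 2" using \<mu> by (simp add: field_simps)
  then have T: "\<tau>2 \<mu> \<sigma> \<le> (\<mu> + \<beta>) / 2" by (simp add: \<tau>2_def field_simps)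
  then have \<tau>: "\<tau>2 \<mu> \<sigma> < \<beta>" using \<mu> by simp
  have "\<sigma> \<le> \<mu> / (K ^ 3 + 2 * K)" by (simp add: \<sigma>_def)
  then have "K ^ 3 + 2 * K \<le> \<mu> / \<sigma>" using K3 \<sigma> by (simp add: field_simps)
  then have "K \<le> cardano \<mu> \<sigma>"
    using cubic_le_iff[of K "cardano \<mu> \<sigma>"] by (simp add: cardano_cubic)
  then have "K\<^sup>2 \<le> (cardano \<mu> \<sigma>)\<^sup>2" using K by (intro power_mono) auto
  then have low: "K\<^sup>2 / (K\<^sup>2 + 1) \<le> low_value \<mu> \<sigma> (p_l \<mu> \<sigma>)"
    unfolding low_value_p_l_cardano[OF \<mu>(1) \<sigma>] by (intro self_over_self_plus_mono) auto
  have "(1 - k) * K\<^sup>2 = K" using k by (simp add: K_def power2_eq_square)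
  then have "k * (K\<^sup>2 + 1) < K\<^sup>2" using k K by (simp add: algebra_simps)
  then have "k < K\<^sup>2 / (K\<^sup>2 + 1)" by (simp add: pos_less_divide_eq add_nonneg_pos)
  moreover have "high_value \<beta> (\<tau>2 \<mu> \<sigma>) (p_h \<mu> \<sigma> \<beta>) \<le> k"
  proof -
    have T0: "0 < \<tau>2 \<mu> \<sigma>" using mean_less_\<tau>2[OF \<mu>(1) \<sigma>] \<mu> by simp
    have h: "p_h \<mu> \<sigma> \<beta> < \<tau>2 \<mu> \<sigma>" unfolding p_h_eq_high_peak by (rule high_peak_bounds[OF T0 \<tau>])
    then have "high_value \<beta> (\<tau>2 \<mu> \<sigma>) (p_h \<mu> \<sigma> \<beta>) \<le> p_h \<mu> \<sigma> \<beta> / \<beta>" by (simp add: high_value_def)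
    also have "\<dots> \<le> ((\<mu> + \<beta>) / 2) / \<beta>" using h T \<mu> by (intro divide_right_mono) auto
    finally show ?thesis by (simp add: k_def)
  qed
  ultimately show thesis using that[OF \<sigma> \<tau>] low by linarith
qed

text \<open>
  As \<open>\<tau>2\<close> tends to \<open>\<beta>\<close>, the distribution is forced onto \<open>0\<close> and \<open>\<beta>\<close>, so \<open>drop_ratio\<close> tends to
  \<open>1\<close> at any fixed price below \<open>\<beta>\<close>; such a price close to \<open>\<beta>\<close> beats any given low value below \<open>1\<close>.
\<close>
lemma high_dominates_near_boundary:
  assumes \<mu>: "0 < \<mu>" "\<mu> < \<beta>" and \<sigma>0: "0 < \<sigma>0" "\<tau>2 \<mu> \<sigma>0 < \<beta>"
  obtains \<sigma> where "\<sigma>0 < \<sigma>" "\<tau>2 \<mu> \<sigma> < \<beta>"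
    "low_value \<mu> \<sigma> (p_l \<mu> \<sigma>) < high_value \<beta> (\<tau>2 \<mu> \<sigma>) (p_h \<mu> \<sigma> \<beta>)"
proof -
  define l where "l = low_value \<mu> \<sigma>0 (p_l \<mu> \<sigma>0)"
  have l: "0 < l" "l < 1"
    using low_value_p_l_pos[OF \<mu>(1) \<sigma>0(1)] low_value_p_l_cardano[OF \<mu>(1) \<sigma>0(1)]
    by (auto simp: l_def add_nonneg_pos)
  \<comment> \<open>A price with \<open>l < p / \<beta> < 1\<close>, so that only \<open>drop_ratio\<close> still has to exceed \<open>l\<close>.\<close>
  define p where "p = (1 + l) / 2 * \<beta>"
  have p: "0 < p" "p < \<beta>" "l < p / \<beta>" using l \<mu> by (auto simp: p_def)
  \<comment> \<open>The value of \<open>\<sigma>\<close> at which \<open>\<tau>2 = \<beta>\<close>.\<close>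
  define S where "S = sqrt (\<mu> * (\<beta> - \<mu>))"
  have S2: "S\<^sup>2 = \<mu> * (\<beta> - \<mu>)" using \<mu> by (simp add: S_def)
  have S0: "0 < S" using \<mu> by (simp add: S_def)
  have \<tau>S: "\<tau>2 \<mu> S = \<beta>" using \<mu> by (simp add: \<tau>2_def S2)
  have "\<sigma>0 < S"
  proof (rule ccontr)
    assume "\<not> \<sigma>0 < S"
    then have "\<tau>2 \<mu> S \<le> \<tau>2 \<mu> \<sigma>0" using \<tau>2_strict_mono[OF \<mu>(1) S0, of \<sigma>0] by (cases "S = \<sigma>0") auto
    then show False using \<tau>S \<sigma>0 by simp
  qed
  have lim: "((\<lambda>\<sigma>. \<tau>2 \<mu> \<sigma>) \<longlongrightarrow> \<beta>) (at_left S)"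
    unfolding \<tau>S[symmetric] unfolding \<tau>2_def using \<mu> by (intro tendsto_intros) auto
  have "0 < p * (\<beta> - p)" using p by simp
  then have "((\<lambda>\<sigma>. drop_ratio \<beta> (\<tau>2 \<mu> \<sigma>) p) \<longlongrightarrow> drop_ratio \<beta> \<beta> p) (at_left S)"
    unfolding drop_ratio_def by (intro tendsto_intros lim) auto
  moreover have "drop_ratio \<beta> \<beta> p = 1" using p by (simp add: drop_ratio_def)
  ultimately have "\<forall>\<^sub>F \<sigma> in at_left S. l < drop_ratio \<beta> (\<tau>2 \<mu> \<sigma>) p"
    using l by (intro order_tendstoD) auto
  moreover have "\<forall>\<^sub>F \<sigma> in at_left S. p < \<tau>2 \<mu> \<sigma>" using lim p by (intro order_tendstoD) auto
  moreover have "\<forall>\<^sub>F \<sigma> in at_left S. \<sigma> \<in> {\<sigma>0<..<S}" using \<open>\<sigma>0 < S\<close> by (rule eventually_at_left_real)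
  ultimately have "\<forall>\<^sub>F \<sigma> in at_left S.
      l < drop_ratio \<beta> (\<tau>2 \<mu> \<sigma>) p \<and> p < \<tau>2 \<mu> \<sigma> \<and> \<sigma> \<in> {\<sigma>0<..<S}"
    by eventually_elim auto
  then obtain \<sigma> where *: "l < drop_ratio \<beta> (\<tau>2 \<mu> \<sigma>) p" "p < \<tau>2 \<mu> \<sigma>" "\<sigma>0 < \<sigma>" "\<sigma> < S"
    by (auto dest: eventually_happens)
  have \<sigma>: "0 < \<sigma>" using * \<sigma>0 by simp
  have \<tau>: "\<tau>2 \<mu> \<sigma> < \<beta>" using \<tau>2_strict_mono[OF \<mu>(1) \<sigma> *(4)] \<tau>S by simp
  have "low_value \<mu> \<sigma> (p_l \<mu> \<sigma>) < l"
    unfolding l_def by (rule low_value_p_l_antimono[OF \<mu>(1) \<sigma>0(1) *(3)])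
  also have "l < high_value \<beta> (\<tau>2 \<mu> \<sigma>) p" using * p by (simp add: high_value_def)
  also have "\<dots> \<le> high_value \<beta> (\<tau>2 \<mu> \<sigma>) (p_h \<mu> \<sigma> \<beta>)"
    by (rule high_value_le_p_h[OF \<mu>(1) \<sigma> \<tau> p(1)])
  finally show thesis using that[OF *(3) \<tau>] by blast
qed

lemma values_tie:
  assumes \<mu>: "0 < \<mu>" "\<mu> < \<beta>"
  obtains \<sigma> where "0 < \<sigma>" "\<tau>2 \<mu> \<sigma> < \<beta>"
    "low_value \<mu> \<sigma> (p_l \<mu> \<sigma>) = high_value \<beta> (\<tau>2 \<mu> \<sigma>) (p_h \<mu> \<sigma> \<beta>)"
proof -
  define G where "G \<sigma> = high_value \<beta> (\<tau>2 \<mu> \<sigma>) (p_h \<mu> \<sigma> \<beta>) - low_value \<mu> \<sigma> (p_l \<mu> \<sigma>)" for \<sigma>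
  obtain a where a: "0 < a" "\<tau>2 \<mu> a < \<beta>" "G a < 0"
    using low_dominates_near_zero[OF \<mu>] unfolding G_def by (metis diff_less_0_iff_less)
  obtain b where b: "a < b" "\<tau>2 \<mu> b < \<beta>" "0 < G b"
    using high_dominates_near_boundary[OF \<mu> a(1,2)] unfolding G_def by (metis diff_gt_0_iff_gt)
  have range: "0 < \<sigma>" "0 < \<tau>2 \<mu> \<sigma>" "\<tau>2 \<mu> \<sigma> < \<beta>" if "\<sigma> \<in> {a..b}" for \<sigma>
  proof -
    show \<sigma>: "0 < \<sigma>" using that a by simp
    then show "0 < \<tau>2 \<mu> \<sigma>" using \<mu> by (simp add: \<tau>2_def add_pos_nonneg)
    show "\<tau>2 \<mu> \<sigma> < \<beta>" using \<tau>2_strict_mono[OF \<mu>(1) \<sigma>, of b] that b by (cases "\<sigma> = b") auto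
  qed
  define h where "h \<sigma> = high_peak \<beta> (\<tau>2 \<mu> \<sigma>)" for \<sigma>
  have h: "0 < h \<sigma>" "h \<sigma> < \<tau>2 \<mu> \<sigma>" if "\<sigma> \<in> {a..b}" for \<sigma>
    using high_peak_bounds range[OF that] by (auto simp: h_def)
  have \<tau>_cont: "continuous_on {a..b} (\<lambda>\<sigma>. \<tau>2 \<mu> \<sigma>)"
    unfolding \<tau>2_def using \<mu> by (intro continuous_intros) auto
  have h_cont: "continuous_on {a..b} h"
    unfolding h_def high_peak_def crossing_def by (intro continuous_intros \<tau>_cont) auto
  have "continuous_on {a..b} (\<lambda>\<sigma>. drop_ratio \<beta> (\<tau>2 \<mu> \<sigma>) (h \<sigma>))"
    unfolding drop_ratio_def
  proof (intro continuous_intros \<tau>_cont h_cont ballI)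
    fix \<sigma> assume \<sigma>: "\<sigma> \<in> {a..b}"
    have "0 < h \<sigma> * (\<tau>2 \<mu> \<sigma> - h \<sigma>) + \<beta> * (\<beta> - \<tau>2 \<mu> \<sigma>)"
      using h[OF \<sigma>] range[OF \<sigma>] \<mu> by (intro add_pos_pos mult_pos_pos) auto
    then show "h \<sigma> * (\<tau>2 \<mu> \<sigma> - h \<sigma>) + \<beta> * (\<beta> - \<tau>2 \<mu> \<sigma>) \<noteq> 0" by simp
  qed
  moreover have "continuous_on {a..b} (\<lambda>\<sigma>. (cardano \<mu> \<sigma>)\<^sup>2 / ((cardano \<mu> \<sigma>)\<^sup>2 + 1))"
  proof -
    have "continuous_on {a..b} (\<lambda>\<sigma>. cardano \<mu> \<sigma>)"
      unfolding cardano_def using a by (intro continuous_intros) auto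
    moreover have "x\<^sup>2 + 1 \<noteq> 0" for x :: real by (metis sum_power2_eq_zero_iff one_power2 zero_neq_one)
    ultimately show ?thesis by (intro continuous_intros) auto
  qed
  ultimately have "continuous_on {a..b}
      (\<lambda>\<sigma>. drop_ratio \<beta> (\<tau>2 \<mu> \<sigma>) (h \<sigma>) - (cardano \<mu> \<sigma>)\<^sup>2 / ((cardano \<mu> \<sigma>)\<^sup>2 + 1))"
    by (rule continuous_on_diff)
  moreover have "G \<sigma> = drop_ratio \<beta> (\<tau>2 \<mu> \<sigma>) (h \<sigma>) - (cardano \<mu> \<sigma>)\<^sup>2 / ((cardano \<mu> \<sigma>)\<^sup>2 + 1)"
    if "\<sigma> \<in> {a..b}" for \<sigma>
    using range[OF that] \<mu>
    by (simp add: G_def p_h_eq_high_peak h_def high_value_high_peak low_value_p_l_cardano)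
  ultimately have "continuous_on {a..b} G" by (subst continuous_on_cong[OF refl]) auto
  then obtain \<sigma> where "a \<le> \<sigma>" "\<sigma> \<le> b" "G \<sigma> = 0" using IVT'[of G a 0 b] a b by auto
  then show thesis using that[of \<sigma>] range[of \<sigma>] by (simp add: G_def)
qed

theorem theorem5p1:
  fixes \<mu> \<beta> :: real
  assumes "0 < \<mu>" and "\<mu> < \<beta>"
  shows "\<exists>\<sigma>star. threshold_eq \<mu> \<beta> \<sigma>star \<and>
           (\<forall>s. threshold_eq \<mu> \<beta> s \<longrightarrow> s = \<sigma>star \<or> (s < \<sigma>star \<and> p_l \<mu> s = p_h \<mu> s \<beta>)) \<and>
           (\<forall>\<sigma>. 0 < \<sigma> \<and> \<tau>2 \<mu> \<sigma> < \<beta> \<longrightarrow>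
              (\<sigma> < \<sigma>star \<longrightarrow> optimal_prices \<mu> \<sigma> \<beta> = {p_l \<mu> \<sigma>}) \<and>
              (\<sigma> = \<sigma>star \<longrightarrow> optimal_prices \<mu> \<sigma> \<beta> = {p_l \<mu> \<sigma>, p_h \<mu> \<sigma> \<beta>}) \<and>
              (\<sigma>star < \<sigma> \<longrightarrow> optimal_prices \<mu> \<sigma> \<beta> = {p_h \<mu> \<sigma> \<beta>}))"
proof -
  define L where "L \<sigma> = low_value \<mu> \<sigma> (p_l \<mu> \<sigma>)" for \<sigma>
  define H where "H \<sigma> = high_value \<beta> (\<tau>2 \<mu> \<sigma>) (p_h \<mu> \<sigma> \<beta>)" for \<sigma>
  have L: "L \<sigma>' < L \<sigma>" if "0 < \<sigma>" "\<sigma> < \<sigma>'" for \<sigma> \<sigma>'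
    unfolding L_def by (rule low_value_p_l_antimono[OF assms(1) that])
  have H: "H \<sigma> \<le> H \<sigma>'" if "0 < \<sigma>" "\<sigma> < \<sigma>'" "\<tau>2 \<mu> \<sigma>' < \<beta>" for \<sigma> \<sigma>'
    unfolding H_def p_h_eq_high_peak
  proof (rule high_peak_value_mono)
    show "0 < \<tau>2 \<mu> \<sigma>" using assms by (simp add: \<tau>2_def add_pos_nonneg)
    show "\<tau>2 \<mu> \<sigma> \<le> \<tau>2 \<mu> \<sigma>'" using \<tau>2_strict_mono[OF assms(1) that(1,2)] by simp
  qed (rule that(3))
  obtain \<sigma>star where star: "0 < \<sigma>star" "\<tau>2 \<mu> \<sigma>star < \<beta>" "L \<sigma>star = H \<sigma>star"
    using values_tie[OF assms] unfolding L_def H_def by blast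
  have below: "H \<sigma> < L \<sigma>" if "0 < \<sigma>" "\<sigma> < \<sigma>star" for \<sigma>
    using L[OF that] H[OF that star(2)] star(3) by linarith
  have above: "L \<sigma> < H \<sigma>" if "\<sigma>star < \<sigma>" "\<tau>2 \<mu> \<sigma> < \<beta>" for \<sigma>
    using L[OF star(1) that(1)] H[OF star(1) that] star(3) by linarith
  show ?thesis
  proof (intro exI[of _ \<sigma>star] conjI allI impI)
    show "threshold_eq \<mu> \<beta> \<sigma>star"
      using star by (intro threshold_eq_tie assms) (auto simp: L_def H_def)
  next
    fix s assume s: "threshold_eq \<mu> \<beta> s"
    then have adm: "0 < s" "\<tau>2 \<mu> s < \<beta>" by (auto simp: threshold_eq_def)
    consider "s < \<sigma>star" | "s = \<sigma>star" | "\<sigma>star < s" by linarith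
    then show "s = \<sigma>star \<or> (s < \<sigma>star \<and> p_l \<mu> s = p_h \<mu> s \<beta>)"
    proof cases
      case 1
      then show ?thesis
        using threshold_eq_low[OF assms(1) adm] below[OF adm(1) 1] s by (auto simp: L_def H_def)
    next
      case 3
      then show ?thesis
        using threshold_eq_high[OF assms(1) adm] above[OF 3 adm(2)] s by (auto simp: L_def H_def)
    qed simp
  next
    fix \<sigma> assume adm: "0 < \<sigma> \<and> \<tau>2 \<mu> \<sigma> < \<beta>" and "\<sigma> < \<sigma>star"
    then show "optimal_prices \<mu> \<sigma> \<beta> = {p_l \<mu> \<sigma>}"
      using below by (intro optimal_prices_low assms(1)) (auto simp: L_def H_def)
  next
    fix \<sigma> assume adm: "0 < \<sigma> \<and> \<tau>2 \<mu> \<sigma> < \<beta>" and "\<sigma> = \<sigma>star"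
    then show "optimal_prices \<mu> \<sigma> \<beta> = {p_l \<mu> \<sigma>, p_h \<mu> \<sigma> \<beta>}"
      using star by (intro optimal_prices_tie assms(1)) (auto simp: L_def H_def)
  next
    fix \<sigma> assume adm: "0 < \<sigma> \<and> \<tau>2 \<mu> \<sigma> < \<beta>" and "\<sigma>star < \<sigma>"
    then show "optimal_prices \<mu> \<sigma> \<beta> = {p_h \<mu> \<sigma> \<beta>}"
      using above by (intro optimal_prices_high assms(1)) (auto simp: L_def H_def)
  qed
qed

end
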